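(* The unit sub-Lorentzian sphere $S=\{q\in M: d(q)=1\}$ of the problem described in the context is homeomorphic to the closed half-plane $\mathbb R^2_+:=\{(a,b)\in\mathbb R^2: b\ge0\}$.
   Context: Let $M=\mathbb R^3$ with coordinates $(x,y,z)$, $X_1=\frac{\partial}{\partial x}$, $X_2=\frac{\partial}{\partial y}+\frac{x^2}{2}\frac{\partial}{\partial z}$, $U_1=\{(u_1,u_2)\in\mathbb R^2: u_2\ge|u_1|\}$, $q_0=(0,0,0)$. An admissible trajectory is a Lipschitz curve $q:[0,t_1]\to M$ ($t_1\ge0$ free) with $\dot q=u_1X_1(q)+u_2X_2(q)$ a.e. for some bounded measurable control $u:[0,t_1]\to U_1$; its length is $l=\int_0^{t_1}\sqrt{u_2^2-u_1^2}\,dt$. The distance $d(q)$ is the supremum of lengths of admissible trajectories from $q_0$ to $q$, and $d(q)=0$ if there are none. $S$ carries the subspace topology of $\mathbb R^3$. *)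

theory Defs
  imports "HOL-Analysis.Analysis"
begin

type_synonym R3 = "real \<times> real \<times> real"

definition X1 :: "R3 \<Rightarrow> R3" where
  "X1 = (\<lambda>(x, y, z). (1, 0, 0))"

definition X2 :: "R3 \<Rightarrow> R3" where
  "X2 = (\<lambda>(x, y, z). (0, 1, x\<^sup>2 / 2))"

definition U1 :: "(real \<times> real) set" where
  "U1 = {(u1, u2). \<bar>u1\<bar> \<le> u2}"

definition q0 :: R3 where
  "q0 = (0, 0, 0)"

(* Functions on [0, t1] are represented by total functions on the reals; every condition, including
   the derivative, is relative to {0..t1}, so the values elsewhere are irrelevant. *)
definition admissible :: "real \<Rightarrow> (real \<Rightarrow> R3) \<Rightarrow> (real \<Rightarrow> real \<times> real) \<Rightarrow> bool" where
  "admissible t1 q u \<longleftrightarrow>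
     0 \<le> t1 \<and>
     (\<exists>L. L-lipschitz_on {0..t1} q) \<and>
     u \<in> borel_measurable (lebesgue_on {0..t1}) \<and>
     bounded (u ` {0..t1}) \<and>
     u ` {0..t1} \<subseteq> U1 \<and>
     (AE t in lebesgue_on {0..t1}.
        (q has_vector_derivative (fst (u t) *\<^sub>R X1 (q t) + snd (u t) *\<^sub>R X2 (q t)))
          (at t within {0..t1}))"

definition sl_length :: "real \<Rightarrow> (real \<Rightarrow> real \<times> real) \<Rightarrow> real" where
  "sl_length t1 u = (LINT t|lebesgue_on {0..t1}. sqrt ((snd (u t))\<^sup>2 - (fst (u t))\<^sup>2))"

definition lengths_to :: "R3 \<Rightarrow> real set" where
  "lengths_to p = {sl_length t1 u |t1 q u. admissible t1 q u \<and> q 0 = q0 \<and> q t1 = p}"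

(* Extended-real valued, so that the supremum is meaningful without a prior boundedness proof. *)
definition sl_dist :: "R3 \<Rightarrow> ereal" where
  "sl_dist p = (if lengths_to p = {} then 0 else (SUP l\<in>lengths_to p. ereal l))"

definition sl_unit_sphere :: "R3 set" where
  "sl_unit_sphere = {p. sl_dist p = 1}"

end

theory Submission
  imports Defs
begin

text \<open>
  Read \<open>y\<close> as time. A trajectory is then a curve \<open>x\<close> of slope at most 1 that starts at 0, its length is
  the integral of \<open>sqrt (1 - x'\<^sup>2)\<close>, and the third coordinate records half the integral of \<open>x\<^sup>2\<close>. The
  dilations \<open>(k x, k y, k\<^sup>3 z)\<close> multiply lengths by \<open>k\<close>. Hence the unit sphere is carried, by
  \<open>(x, y, z) \<mapsto> (x / y, z / y\<^sup>3)\<close>, bijectively onto the set of points of the plane \<open>y = 1\<close> at which the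
  distance is positive, and the inverse is continuous once the distance is continuous on that set.

  The set is explicit. For a given end value \<open>a\<close> of \<open>x\<close> with \<open>\<bar>a\<bar> < 1\<close>,
  by reflection with \<open>a \<ge> 0\<close>, the least height \<open>\<bar>a\<bar>\<^sup>3 / 6\<close> is reached by waiting at 0 and
  leaving at slope 1 at the last possible moment, with length \<open>1 - \<bar>a\<bar>\<close>; the greatest
  height is reached by moving out at slope 1 and back at slope -1, with length 0. All heights in between,
  the least one included, are reached with positive length. So the set is bounded below by a curve that
  belongs to it and above by a curve that does not, and it is a half-plane.

  No formula for the distance is used in the proof of its continuity. In the variable \<open>q = x\<^sup>2\<close> the
  length is the integral of \<open>sqrt (1 - q'\<^sup>2 / (4 q))\<close>, and \<open>q'\<^sup>2 / q\<close> is a jointly convex function of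
  \<open>(q, q')\<close>, while the height is linear in \<open>q\<close>: the distance is concave in the coordinates \<open>(x\<^sup>2, z)\<close>.
  The lemma \<open>mix_with_curve\<close> says as much of this as is needed, with one of the two curves explicit, and
  gives continuity at the points with \<open>x \<noteq> 0\<close> above the lower boundary curve. The line \<open>x = 0\<close> is a
  boundary in these coordinates; there a lightlike segment leading back to \<open>x = 0\<close> completes the argument
  (\<open>slice_dist_append\<close>). On the lower boundary curve, mixing gives the lower bound for the distance
  and a calibration the upper one (\<open>control_length_le_near_bottom\<close>). A second calibration
  (\<open>control_length_le_near_top\<close>) shows that trajectories of greatest height have length 0.
\<close>

section \<open>Lipschitz functions and their almost everywhere derivatives\<close>

text \<open>
  With the Lipschitz constant hidden behind an existential quantifier, closure under products and
  compositions takes the form of introduction rules without side computations.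
\<close>

definition lipschitz_fun :: "real set \<Rightarrow> (real \<Rightarrow> real) \<Rightarrow> bool" where
  "lipschitz_fun S f \<longleftrightarrow> (\<exists>C. C-lipschitz_on S f)"

named_theorems lipschitz_fun_intros

lemma lipschitz_fun_const [lipschitz_fun_intros]: "lipschitz_fun S (\<lambda>t. c)"
  unfolding lipschitz_fun_def using lipschitz_on_constant by blast

lemma lipschitz_fun_ident [lipschitz_fun_intros]: "lipschitz_fun S (\<lambda>t. t)"
  unfolding lipschitz_fun_def using lipschitz_on_id by blast

lemma lipschitz_fun_add [lipschitz_fun_intros]:
  "lipschitz_fun S f \<Longrightarrow> lipschitz_fun S g \<Longrightarrow> lipschitz_fun S (\<lambda>t. f t + g t)"
  unfolding lipschitz_fun_def using lipschitz_on_add by blast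

lemma lipschitz_fun_diff [lipschitz_fun_intros]:
  "lipschitz_fun S f \<Longrightarrow> lipschitz_fun S g \<Longrightarrow> lipschitz_fun S (\<lambda>t. f t - g t)"
  unfolding lipschitz_fun_def using lipschitz_on_diff by blast

lemma lipschitz_fun_minus [lipschitz_fun_intros]:
  "lipschitz_fun S f \<Longrightarrow> lipschitz_fun S (\<lambda>t. - f t)"
  unfolding lipschitz_fun_def using lipschitz_on_minus by blast

lemma lipschitz_fun_continuous: "lipschitz_fun S f \<Longrightarrow> continuous_on S f"
  unfolding lipschitz_fun_def using lipschitz_on_continuous_on by blast

lemma lipschitz_fun_bounded:
  assumes "lipschitz_fun {a..b} f"
  obtains B where "0 < B" "\<And>t. t \<in> {a..b} \<Longrightarrow> \<bar>f t\<bar> \<le> B"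
proof -
  have "bounded (f ` {a..b})"
    using assms by (intro compact_imp_bounded compact_continuous_image lipschitz_fun_continuous) auto
  then show thesis using that unfolding bounded_pos by auto
qed

lemma lipschitz_fun_mult [lipschitz_fun_intros]:
  assumes f: "lipschitz_fun {a..b} f" and g: "lipschitz_fun {a..b} g"
  shows "lipschitz_fun {a..b} (\<lambda>t. f t * g t)"
proof -
  obtain A where A: "0 < A" "\<And>t. t \<in> {a..b} \<Longrightarrow> \<bar>f t\<bar> \<le> A"
    using lipschitz_fun_bounded[OF f] by blast
  obtain B where B: "0 < B" "\<And>t. t \<in> {a..b} \<Longrightarrow> \<bar>g t\<bar> \<le> B"
    using lipschitz_fun_bounded[OF g] by blast
  obtain C where C: "C-lipschitz_on {a..b} f" using f unfolding lipschitz_fun_def by blast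
  obtain E where E: "E-lipschitz_on {a..b} g" using g unfolding lipschitz_fun_def by blast
  have "(A * E + B * C)-lipschitz_on {a..b} (\<lambda>t. f t * g t)"
  proof (rule lipschitz_onI)
    fix s t assume st: "s \<in> {a..b}" "t \<in> {a..b}"
    have "\<bar>f s * g s - f t * g t\<bar> = \<bar>f s * (g s - g t) + g t * (f s - f t)\<bar>"
      by (simp add: algebra_simps)
    also have "\<dots> \<le> \<bar>f s\<bar> * \<bar>g s - g t\<bar> + \<bar>g t\<bar> * \<bar>f s - f t\<bar>"
      by (metis abs_mult abs_triangle_ineq)
    also have "\<dots> \<le> A * (E * dist s t) + B * (C * dist s t)"
      using A B st lipschitz_onD[OF C st] lipschitz_onD[OF E st]
      by (intro add_mono mult_mono) (auto simp: dist_real_def)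
    finally show "dist (f s * g s) (f t * g t) \<le> (A * E + B * C) * dist s t"
      by (simp add: dist_real_def algebra_simps)
  qed (use A B lipschitz_on_nonneg[OF C] lipschitz_on_nonneg[OF E] in auto)
  then show ?thesis unfolding lipschitz_fun_def by blast
qed

lemma lipschitz_fun_power [lipschitz_fun_intros]:
  "lipschitz_fun {a..b} f \<Longrightarrow> lipschitz_fun {a..b} (\<lambda>t. f t ^ n)"
proof (induction n)
  case (Suc n)
  from lipschitz_fun_mult[OF Suc.prems Suc.IH[OF Suc.prems]] show ?case by simp
qed (simp add: lipschitz_fun_const)

lemma lipschitz_fun_divide_const [lipschitz_fun_intros]:
  "lipschitz_fun {a..b} f \<Longrightarrow> lipschitz_fun {a..b} (\<lambda>t. f t / c)"
  using lipschitz_fun_mult[OF _ lipschitz_fun_const, of a b f "1 / c"] by simp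

lemma lipschitz_fun_compose:
  assumes "lipschitz_fun S f" "lipschitz_fun R g" "f ` S \<subseteq> R"
  shows "lipschitz_fun S (\<lambda>t. g (f t))"
proof -
  obtain C where C: "C-lipschitz_on S f" using assms unfolding lipschitz_fun_def by blast
  obtain E where E: "E-lipschitz_on R g" using assms unfolding lipschitz_fun_def by blast
  have "(E * C)-lipschitz_on S (\<lambda>t. g (f t))"
    by (rule lipschitz_on_compose2[OF C lipschitz_on_subset[OF E assms(3)]])
  then show ?thesis unfolding lipschitz_fun_def by blast
qed

lemma lipschitz_fun_arctan [lipschitz_fun_intros]:
  assumes "lipschitz_fun S f"
  shows "lipschitz_fun S (\<lambda>t. arctan (f t))"
proof -
  have "1-lipschitz_on UNIV (arctan :: real \<Rightarrow> real)"
  proof (rule lipschitz_onI)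
    fix p q :: real
    have "norm (arctan p - arctan q) \<le> 1 * norm (p - q)"
    proof (rule field_differentiable_bound[of UNIV])
      show "(arctan has_field_derivative inverse (1 + w\<^sup>2)) (at w within UNIV)" for w :: real
        using DERIV_arctan by auto
      show "norm (inverse (1 + w\<^sup>2)) \<le> 1" for w :: real
        using zero_le_power2[of w] by (simp add: inverse_le_1_iff)
    qed auto
    then show "dist (arctan p) (arctan q) \<le> 1 * dist p q" by (simp add: dist_norm)
  qed auto
  then have "lipschitz_fun UNIV arctan" unfolding lipschitz_fun_def by blast
  then show ?thesis by (rule lipschitz_fun_compose[OF assms]) auto
qed

lemma lipschitz_fun_cong:
  "lipschitz_fun S f \<Longrightarrow> (\<And>t. t \<in> S \<Longrightarrow> f t = g t) \<Longrightarrow> lipschitz_fun S g"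
  unfolding lipschitz_fun_def by (metis lipschitz_on_cong)

lemma lipschitz_fun_sqrt_sum_squares:
  assumes "lipschitz_fun S f" "lipschitz_fun S g"
  shows "lipschitz_fun S (\<lambda>t. sqrt ((f t)\<^sup>2 + (g t)\<^sup>2))"
proof -
  obtain A B where "A-lipschitz_on S f" "B-lipschitz_on S g"
    using assms unfolding lipschitz_fun_def by blast
  from lipschitz_on_Pair[OF this] obtain C where C: "C-lipschitz_on S (\<lambda>t. (f t, g t))" ..
  have "C-lipschitz_on S (\<lambda>t. norm (f t, g t))"
  proof (rule lipschitz_onI)
    fix s t assume "s \<in> S" "t \<in> S"
    have "dist (norm (f s, g s)) (norm (f t, g t)) \<le> dist (f s, g s) (f t, g t)"
      by (simp only: dist_norm real_norm_def norm_triangle_ineq3)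
    also have "\<dots> \<le> C * dist s t" by (rule lipschitz_onD[OF C]) fact+
    finally show "dist (norm (f s, g s)) (norm (f t, g t)) \<le> C * dist s t" .
  qed (rule lipschitz_on_nonneg[OF C])
  then show ?thesis unfolding lipschitz_fun_def norm_Pair by auto
qed

lemma lipschitz_fun_max [lipschitz_fun_intros]:
  assumes "lipschitz_fun S f"
  shows "lipschitz_fun S (\<lambda>t. max c (f t))"
proof -
  have "1-lipschitz_on UNIV (max c)"
    by (auto intro!: lipschitz_onI simp: dist_real_def)
  then have "lipschitz_fun UNIV (max c)"
    unfolding lipschitz_fun_def by blast
  then show ?thesis
    using lipschitz_fun_compose[OF assms] by blast
qed

lemma lipschitz_fun_glue:
  assumes "lipschitz_fun {a..b} f" "lipschitz_fun {b..c} g" "f b = g b"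
  shows "lipschitz_fun {a..c} (\<lambda>t. if t \<le> b then f t else g t)"
  using assms lipschitz_on_concat_max unfolding lipschitz_fun_def by metis

lemma lipschitz_fun_subset: "lipschitz_fun S f \<Longrightarrow> R \<subseteq> S \<Longrightarrow> lipschitz_fun R f"
  unfolding lipschitz_fun_def using lipschitz_on_subset by blast


text \<open>
  The difference quotients of \<open>g\<close> are bounded by its Lipschitz constant and converge to \<open>D\<close> almost
  everywhere. Their integrals telescope to averages of \<open>g\<close> next to the two end points, so dominated
  convergence gives the fundamental theorem of calculus for \<open>g\<close>.
\<close>

lemma has_integral_derivative_of_lipschitz:
  fixes g D :: "real \<Rightarrow> real"
  assumes lip: "C-lipschitz_on {a..b} g" and ab: "a \<le> b" and N: "negligible N"
    and der: "\<And>t. t \<in> {a..b} - N \<Longrightarrow> (g has_real_derivative D t) (at t within {a..b})"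
  shows "(D has_integral (g b - g a)) {a..b}"
proof -
  \<comment> \<open>The constant extension makes the forward difference quotients meaningful up to
    \<open>b\<close>.\<close>
  define G where "G t = g (max a (min b t))" for t
  have lipG: "C-lipschitz_on UNIV G"
  proof (rule lipschitz_onI)
    fix x y :: real
    have "dist (G x) (G y) \<le> C * dist (max a (min b x)) (max a (min b y))"
      unfolding G_def by (rule lipschitz_onD[OF lip]) (use ab in auto)
    also have "\<dots> \<le> C * dist x y"
      using lipschitz_on_nonneg[OF lip]
      by (intro mult_left_mono) (auto simp: dist_real_def)
    finally show "dist (G x) (G y) \<le> C * dist x y" .
  qed (use lipschitz_on_nonneg[OF lip] in auto)
  have contG: "continuous_on A G" for A
    using lipschitz_on_continuous_on[OF lipG] continuous_on_subset by blast
  define P where "P t = integral {a..t} G" for t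
  have P: "(P has_real_derivative G t) (at t within {a..b+1})" if "t \<in> {a..b+1}" for t
    unfolding P_def by (rule integral_has_real_derivative[OF contG that])
  define h :: "nat \<Rightarrow> real" where "h n = 1 / (real n + 1)" for n
  have h: "0 < h n" "h n \<le> 1" for n by (auto simp: h_def)
  have h0: "h \<longlonglongrightarrow> 0" unfolding h_def using LIMSEQ_inverse_real_of_nat
    by (simp add: inverse_eq_divide add.commute)
  define f where "f n t = (G (t + h n) - G t) / h n" for n t
  \<comment> \<open>The integral of the \<open>n\<close>-th difference quotient, by the antiderivative \<open>P\<close>
    of \<open>G\<close>.\<close>
  define y where "y n = (P (b + h n) - P b) / h n - (P (a + h n) - P a) / h n" for n
  have fint: "(f n has_integral y n) {a..b}" for n
  proof -
    have "((\<lambda>t. (P (t + h n) - P t) / h n) has_real_derivative f n t) (at t within {a..b})"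
      if t: "t \<in> {a..b}" for t
    proof -
      have "((\<lambda>t. P (t + h n)) has_real_derivative G (t + h n) * 1) (at t within {a..b})"
      proof (rule DERIV_image_chain[where f = P and g = "\<lambda>t. t + h n", unfolded o_def])
        show "((\<lambda>t. t + h n) has_real_derivative 1) (at t within {a..b})"
          by (auto intro!: derivative_eq_intros)
        show "(P has_real_derivative G (t + h n)) (at (t + h n) within (\<lambda>t. t + h n) ` {a..b})"
          by (rule DERIV_subset[OF P]) (use t h[of n] in auto)
      qed
      moreover have "(P has_real_derivative G t) (at t within {a..b})"
        by (rule DERIV_subset[OF P]) (use t in auto)
      ultimately show ?thesis unfolding f_def
        using h[of n] by (auto intro!: derivative_eq_intros)
    qed
    then have "(f n has_integral ((P (b + h n) - P b) / h n - (P (a + h n) - P a) / h n)) {a..b}"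
      by (intro fundamental_theorem_of_calculus[OF ab])
         (simp add: has_real_derivative_iff_has_vector_derivative)
    then show ?thesis by (simp add: y_def)
  qed
  have quot: "(\<lambda>n. (P (c + h n) - P c) / h n) \<longlonglongrightarrow> G c" if "c \<in> {a..b}" for c
  proof -
    have lim: "((\<lambda>s. (P s - P c) / (s - c)) \<longlongrightarrow> G c) (at c within {a..b+1})"
      using P[of c] that by (simp add: has_field_derivative_iff)
    have "filterlim (\<lambda>n. c + h n) (at c within {a..b+1}) sequentially"
      unfolding filterlim_at
    proof
      have "c + h n \<in> {a..b+1} \<and> c + h n \<noteq> c" for n
        using that h[of n] by auto
      then show "\<forall>\<^sub>F n in sequentially. c + h n \<in> {a..b+1} \<and> c + h n \<noteq> c"
        by simp
    qed (auto intro!: tendsto_eq_intros h0)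
    from filterlim_compose[OF lim this] show ?thesis by simp
  qed
  have "y \<longlonglongrightarrow> G b - G a" unfolding y_def
    by (intro tendsto_diff quot) (use ab in auto)
  then have ylim: "y \<longlonglongrightarrow> g b - g a" using ab by (simp add: G_def)
  \<comment> \<open>At \<open>b\<close> itself the forward quotients of the extension vanish, so \<open>b\<close> joins
    the exceptional set.\<close>
  define f' where "f' n t = (if t \<in> N \<union> {b} then 0 else f n t)" for n t
  define D' where "D' t = (if t \<in> N \<union> {b} then 0 else D t)" for t
  have Nb: "negligible (N \<union> {b})" using N by auto
  have "(D' has_integral (g b - g a)) {a..b}"
  proof (rule has_integral_dominated_convergence[where f = f' and y = y and h = "\<lambda>_. C"])
    show "(f' n has_integral y n) {a..b}" for n
      by (rule has_integral_spike[OF Nb _ fint]) (auto simp: f'_def)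
    show "(\<lambda>_. C) integrable_on {a..b}" by (rule integrable_const_ivl)
    show "\<forall>x\<in>{a..b}. norm (f' n x) \<le> C" for n
    proof
      fix x
      have "\<bar>G (x + h n) - G x\<bar> \<le> C * h n"
        using lipschitz_onD[OF lipG, of "x + h n" x] h[of n] by (auto simp: dist_real_def)
      then show "norm (f' n x) \<le> C"
        using h[of n] lipschitz_on_nonneg[OF lip] by (auto simp: f'_def f_def divide_simps)
    qed
    show "\<forall>t\<in>{a..b}. (\<lambda>n. f' n t) \<longlonglongrightarrow> D' t"
    proof
      fix t assume t: "t \<in> {a..b}"
      show "(\<lambda>n. f' n t) \<longlonglongrightarrow> D' t"
      proof (cases "t \<in> N \<union> {b}")
        case False
        have lim: "((\<lambda>s. (g s - g t) / (s - t)) \<longlongrightarrow> D t) (at t within {a..b})"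
          using der[of t] t False by (simp add: has_field_derivative_iff)
        have "eventually (\<lambda>n. h n < b - t) sequentially"
          by (rule order_tendstoD[OF h0]) (use t False in auto)
        then have ev: "eventually (\<lambda>n. t + h n \<in> {a..b} \<and> t + h n \<noteq> t) sequentially"
        proof eventually_elim
          case (elim n)
          then show ?case using t h[of n] by auto
        qed
        then have "filterlim (\<lambda>n. t + h n) (at t within {a..b}) sequentially"
          unfolding filterlim_at by (auto intro!: tendsto_eq_intros h0)
        from filterlim_compose[OF lim this]
        have "(\<lambda>n. (g (t + h n) - g t) / h n) \<longlonglongrightarrow> D t" by simp
        moreover have "eventually (\<lambda>n. (g (t + h n) - g t) / h n = f' n t) sequentially"
          using ev by eventually_elim (use t False in \<open>auto simp: f'_def f_def G_def max_def min_def\<close>)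
        ultimately show ?thesis using False by (auto simp: D'_def elim: Lim_transform_eventually)
      qed (auto simp: f'_def D'_def)
    qed
    show "y \<longlonglongrightarrow> g b - g a" by (rule ylim)
  qed
  then show ?thesis
    by (rule has_integral_spike[OF Nb, rotated]) (auto simp: D'_def)
qed

lemma lipschitz_fun_increase:
  fixes \<Phi> D :: "real \<Rightarrow> real"
  assumes lip: "lipschitz_fun {a..b} \<Phi>" and ab: "a \<le> b" and N: "negligible N"
    and der: "\<And>t. t \<in> {a..b} - N \<Longrightarrow> (\<Phi> has_real_derivative D t) (at t within {a..b})"
    and f: "(f has_integral I) {a..b}" and le: "\<And>t. t \<in> {a..b} - N \<Longrightarrow> f t \<le> D t"
  shows "I \<le> \<Phi> b - \<Phi> a"
proof -
  obtain C where "C-lipschitz_on {a..b} \<Phi>" using lip unfolding lipschitz_fun_def by blast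
  from has_integral_derivative_of_lipschitz[OF this ab N der]
  have D: "(D has_integral (\<Phi> b - \<Phi> a)) {a..b}" .
  have "((\<lambda>t. if t \<in> N then f t else D t) has_integral (\<Phi> b - \<Phi> a)) {a..b}"
    by (rule has_integral_spike[OF N _ D]) auto
  from has_integral_le[OF f this] le show ?thesis by auto
qed

lemma lipschitz_fun_mono:
  fixes \<Phi> D :: "real \<Rightarrow> real"
  assumes "lipschitz_fun {a..b} \<Phi>" "a \<le> b" "negligible N"
    and "\<And>t. t \<in> {a..b} - N \<Longrightarrow> (\<Phi> has_real_derivative D t) (at t within {a..b})"
    and "\<And>t. t \<in> {a..b} - N \<Longrightarrow> 0 \<le> D t"
  shows "\<Phi> a \<le> \<Phi> b"
  using lipschitz_fun_increase[OF assms(1-4), of "\<lambda>_. 0" 0] assms(5) by auto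

lemma integrable_bounded_on_Icc:
  fixes f :: "real \<Rightarrow> real"
  assumes "f \<in> borel_measurable (lebesgue_on {a..b})" "\<And>t. t \<in> {a..b} \<Longrightarrow> \<bar>f t\<bar> \<le> B"
  shows "integrable (lebesgue_on {a..b}) f"
proof -
  interpret finite_measure "lebesgue_on {a..b}"
    by (rule finite_measure_lebesgue_on) auto
  show ?thesis
    by (rule integrable_const_bound[where B = B]) (use assms in \<open>auto intro!: AE_I2\<close>)
qed

lemma AE_lebesgue_on_iff_negligible:
  assumes "S \<in> sets lebesgue"
  shows "(AE t in lebesgue_on S. P t) \<longleftrightarrow> (\<exists>N. negligible N \<and> (\<forall>t\<in>S - N. P t))"
proof -
  have "(AE t in lebesgue_on S. P t) \<longleftrightarrow> (AE t in lebesgue. t \<in> S \<longrightarrow> P t)"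
    using assms by (intro AE_restrict_space_iff) auto
  also have "\<dots> \<longleftrightarrow> (\<exists>N. negligible N \<and> (\<forall>t\<in>S - N. P t))"
    unfolding eventually_ae_filter negligible_iff_null_sets
  proof (intro iffI; elim bexE exE conjE)
    fix N assume "N \<in> null_sets lebesgue" "{t \<in> space lebesgue. \<not> (t \<in> S \<longrightarrow> P t)} \<subseteq> N"
    then show "\<exists>N. N \<in> null_sets lebesgue \<and> (\<forall>t\<in>S - N. P t)" by auto
  next
    fix N assume "N \<in> null_sets lebesgue" "\<forall>t\<in>S - N. P t"
    then show "\<exists>N\<in>null_sets lebesgue. {t \<in> space lebesgue. \<not> (t \<in> S \<longrightarrow> P t)} \<subseteq> N" by auto
  qed
  finally show ?thesis .
qed

section \<open>Trajectories in coordinates\<close>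

text \<open>
  An admissible trajectory from the origin with the curve and its control split into real coordinates, so
  that one-dimensional calculus applies.
\<close>

locale trajectory =
  fixes T :: real and x y z u v :: "real \<Rightarrow> real"
  assumes T_nonneg: "0 \<le> T"
    and lip_x: "lipschitz_fun {0..T} x"
    and lip_y: "lipschitz_fun {0..T} y"
    and lip_z: "lipschitz_fun {0..T} z"
    and meas_u: "u \<in> borel_measurable (lebesgue_on {0..T})"
    and meas_v: "v \<in> borel_measurable (lebesgue_on {0..T})"
    and bounded_v: "\<exists>B. \<forall>t\<in>{0..T}. v t \<le> B"
    and causal: "\<And>t. t \<in> {0..T} \<Longrightarrow> \<bar>u t\<bar> \<le> v t"
    and start: "x 0 = 0" "y 0 = 0" "z 0 = 0"
    and dynamics: "\<exists>N. negligible N \<and> (\<forall>t\<in>{0..T} - N.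
          (x has_real_derivative u t) (at t within {0..T}) \<and>
          (y has_real_derivative v t) (at t within {0..T}) \<and>
          (z has_real_derivative (x t)\<^sup>2 / 2 * v t) (at t within {0..T}))"

definition control_length :: "real \<Rightarrow> (real \<Rightarrow> real) \<Rightarrow> (real \<Rightarrow> real) \<Rightarrow> real" where
  "control_length T u v = (LINT t|lebesgue_on {0..T}. sqrt ((v t)\<^sup>2 - (u t)\<^sup>2))"

lemma lipschitz_fun_components:
  fixes q :: "real \<Rightarrow> R3"
  assumes "C-lipschitz_on S q"
  shows "lipschitz_fun S (\<lambda>t. fst (q t))" "lipschitz_fun S (\<lambda>t. fst (snd (q t)))"
    "lipschitz_fun S (\<lambda>t. snd (snd (q t)))"
proof -
  have C: "0 \<le> C" using lipschitz_on_nonneg[OF assms] .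
  have *: "C-lipschitz_on S (\<lambda>t. f (q t))"
    if "\<And>p r. dist (f p) (f r) \<le> dist p r" for f :: "R3 \<Rightarrow> real"
    using lipschitz_onD[OF assms] C that by (intro lipschitz_onI) (meson order_trans)+
  have "dist (fst (snd p)) (fst (snd r)) \<le> dist p r" "dist (snd (snd p)) (snd (snd r)) \<le> dist p r"
    for p r :: R3
    by (meson dist_fst_le dist_snd_le order_trans)+
  then show "lipschitz_fun S (\<lambda>t. fst (q t))" "lipschitz_fun S (\<lambda>t. fst (snd (q t)))"
    "lipschitz_fun S (\<lambda>t. snd (snd (q t)))"
    unfolding lipschitz_fun_def using *[of fst] *[of "\<lambda>p. fst (snd p)"] *[of "\<lambda>p. snd (snd p)"] dist_fst_le
    by blast+
qed

lemma trajectory_of_admissible: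
  assumes "admissible T q w" "q 0 = q0"
  shows "trajectory T (\<lambda>t. fst (q t)) (\<lambda>t. fst (snd (q t))) (\<lambda>t. snd (snd (q t)))
           (\<lambda>t. fst (w t)) (\<lambda>t. snd (w t))"
proof
  note a = assms[unfolded admissible_def]
  obtain C where C: "C-lipschitz_on {0..T} q" using a by blast
  show "0 \<le> T" using a by blast
  show "lipschitz_fun {0..T} (\<lambda>t. fst (q t))" "lipschitz_fun {0..T} (\<lambda>t. fst (snd (q t)))"
    "lipschitz_fun {0..T} (\<lambda>t. snd (snd (q t)))"
    using lipschitz_fun_components[OF C] by auto
  have w: "w \<in> borel_measurable (lebesgue_on {0..T})" using a by blast
  show "(\<lambda>t. fst (w t)) \<in> borel_measurable (lebesgue_on {0..T})"
    "(\<lambda>t. snd (w t)) \<in> borel_measurable (lebesgue_on {0..T})"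
    by (rule measurable_compose[OF w], rule borel_measurable_continuous_onI, intro continuous_intros)+
  have "bounded (w ` {0..T})" using a by blast
  then obtain B where B: "\<And>t. t \<in> {0..T} \<Longrightarrow> norm (w t) \<le> B"
    unfolding bounded_iff by blast
  show "\<exists>B. \<forall>t\<in>{0..T}. snd (w t) \<le> B"
  proof (intro exI ballI)
    fix t assume "t \<in> {0..T}"
    from B[OF this] norm_snd_le[of "snd (w t)" "fst (w t)"] have "norm (snd (w t)) \<le> B"
      by simp
    then show "snd (w t) \<le> B" by simp
  qed
  show "\<bar>fst (w t)\<bar> \<le> snd (w t)" if "t \<in> {0..T}" for t
    using a that unfolding U1_def by force
  show "fst (q 0) = 0" "fst (snd (q 0)) = 0" "snd (snd (q 0)) = 0"
    using assms by (auto simp: q0_def)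
  have "AE t in lebesgue_on {0..T}.
        (q has_vector_derivative (fst (w t) *\<^sub>R X1 (q t) + snd (w t) *\<^sub>R X2 (q t))) (at t within {0..T})"
    using a by blast
  then obtain N where N: "negligible N" and der: "\<And>t. t \<in> {0..T} - N \<Longrightarrow>
        (q has_vector_derivative (fst (w t) *\<^sub>R X1 (q t) + snd (w t) *\<^sub>R X2 (q t))) (at t within {0..T})"
    by (subst (asm) AE_lebesgue_on_iff_negligible) auto
  have "((\<lambda>t. fst (q t)) has_real_derivative fst (w t)) (at t within {0..T})
      \<and> ((\<lambda>t. fst (snd (q t))) has_real_derivative snd (w t)) (at t within {0..T})
      \<and> ((\<lambda>t. snd (snd (q t))) has_real_derivative (fst (q t))\<^sup>2 / 2 * snd (w t)) (at t within {0..T})"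
    if "t \<in> {0..T} - N" for t
  proof -
    obtain p1 p2 p3 where p: "q t = (p1, p2, p3)" by (cases "q t") auto
    have d: "(q has_vector_derivative (fst (w t), snd (w t), p1\<^sup>2 / 2 * snd (w t))) (at t within {0..T})"
      using der[OF that] by (simp add: X1_def X2_def p mult.commute)
    have f: "((\<lambda>t. f (q t)) has_vector_derivative f (fst (w t), snd (w t), p1\<^sup>2 / 2 * snd (w t))) (at t within {0..T})"
      if "bounded_linear f" for f :: "R3 \<Rightarrow> real"
      using bounded_linear.has_vector_derivative[OF that d] .
    show ?thesis
      using f[of fst] f[of "\<lambda>p. fst (snd p)"] f[of "\<lambda>p. snd (snd p)"]
      by (auto simp: has_real_derivative_iff_has_vector_derivative p bounded_linear_fst bounded_linear_snd
          intro: bounded_linear_compose[OF bounded_linear_fst bounded_linear_snd, unfolded o_def]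
           bounded_linear_compose[OF bounded_linear_snd bounded_linear_snd, unfolded o_def])
  qed
  then show "\<exists>N. negligible N \<and> (\<forall>t\<in>{0..T} - N.
       ((\<lambda>t. fst (q t)) has_real_derivative fst (w t)) (at t within {0..T})
      \<and> ((\<lambda>t. fst (snd (q t))) has_real_derivative snd (w t)) (at t within {0..T})
      \<and> ((\<lambda>t. snd (snd (q t))) has_real_derivative (fst (q t))\<^sup>2 / 2 * snd (w t)) (at t within {0..T}))"
    using N by blast
qed

lemma (in trajectory) admissible_Pair:
  "admissible T (\<lambda>t. (x t, y t, z t)) (\<lambda>t. (u t, v t))"
proof -
  have "\<exists>L. L-lipschitz_on {0..T} (\<lambda>t. (x t, y t, z t))"
  proof -
    obtain A B C where "A-lipschitz_on {0..T} x" "B-lipschitz_on {0..T} y" "C-lipschitz_on {0..T} z"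
      using lip_x lip_y lip_z unfolding lipschitz_fun_def by blast
    from lipschitz_on_Pair[OF this(1) lipschitz_on_Pair[OF this(2,3)]] show ?thesis ..
  qed
  moreover have "(\<lambda>t. (u t, v t)) \<in> borel_measurable (lebesgue_on {0..T})"
    using borel_measurable_Pair[OF meas_u meas_v] .
  moreover have "bounded ((\<lambda>t. (u t, v t)) ` {0..T})"
  proof -
    obtain B where B: "\<And>t. t \<in> {0..T} \<Longrightarrow> v t \<le> B" using bounded_v by blast
    have "(\<lambda>t. (u t, v t)) ` {0..T} \<subseteq> {-B..B} \<times> {-B..B}"
      using B causal by force
    then show ?thesis
      by (rule bounded_subset[rotated]) (intro bounded_Times bounded_closed_interval)
  qed
  moreover have "(\<lambda>t. (u t, v t)) ` {0..T} \<subseteq> U1" using causal by (auto simp: U1_def)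
  moreover have "AE t in lebesgue_on {0..T}. ((\<lambda>t. (x t, y t, z t)) has_vector_derivative
      (u t *\<^sub>R X1 (x t, y t, z t) + v t *\<^sub>R X2 (x t, y t, z t))) (at t within {0..T})"
  proof (subst AE_lebesgue_on_iff_negligible)
    obtain N where N: "negligible N" "\<forall>t\<in>{0..T} - N.
          (x has_real_derivative u t) (at t within {0..T}) \<and>
          (y has_real_derivative v t) (at t within {0..T}) \<and>
          (z has_real_derivative (x t)\<^sup>2 / 2 * v t) (at t within {0..T})"
      using dynamics by blast
    then show "\<exists>N. negligible N \<and> (\<forall>t\<in>{0..T} - N. ((\<lambda>t. (x t, y t, z t)) has_vector_derivative
      (u t *\<^sub>R X1 (x t, y t, z t) + v t *\<^sub>R X2 (x t, y t, z t))) (at t within {0..T}))"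
      by (intro exI[of _ N])
         (auto simp: X1_def X2_def has_real_derivative_iff_has_vector_derivative mult.commute
           intro!: has_vector_derivative_Pair)
  qed auto
  ultimately show ?thesis using T_nonneg unfolding admissible_def by simp
qed

lemma lengths_to_iff:
  "l \<in> lengths_to (a, b, c) \<longleftrightarrow>
     (\<exists>T x y z u v. trajectory T x y z u v \<and> x T = a \<and> y T = b \<and> z T = c \<and> l = control_length T u v)"
proof
  assume "l \<in> lengths_to (a, b, c)"
  then obtain T q w where *: "admissible T q w" "q 0 = q0" "q T = (a, b, c)" "l = sl_length T w"
    unfolding lengths_to_def by blast
  show "\<exists>T x y z u v. trajectory T x y z u v \<and> x T = a \<and> y T = b \<and> z T = c \<and> l = control_length T u v"
    by (rule exI, rule exI, rule exI, rule exI, rule exI, rule exI,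
        rule conjI, rule trajectory_of_admissible[OF *(1,2)])
       (use * in \<open>simp add: sl_length_def control_length_def\<close>)
next
  assume "\<exists>T x y z u v. trajectory T x y z u v \<and> x T = a \<and> y T = b \<and> z T = c \<and> l = control_length T u v"
  then obtain T x y z u v where *: "trajectory T x y z u v" "x T = a" "y T = b" "z T = c" "l = control_length T u v"
    by blast
  interpret trajectory T x y z u v by fact
  show "l \<in> lengths_to (a, b, c)"
    unfolding lengths_to_def using admissible_Pair * start
    by (intro CollectI exI[of _ T] exI[of _ "\<lambda>t. (x t, y t, z t)"] exI[of _ "\<lambda>t. (u t, v t)"])
       (auto simp: q0_def sl_length_def control_length_def)
qed

text \<open>
  The vector fields are homogeneous under \<open>(x, y, z) \<mapsto> (k x, k y, k\<^sup>3 z)\<close>, so a dilated trajectory is the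
  trajectory of the control multiplied by \<open>k\<close>.
\<close>

lemma lengths_to_dilate:
  assumes "l \<in> lengths_to (a, b, c)" "0 < k"
  shows "k * l \<in> lengths_to (k * a, k * b, k ^ 3 * c)"
proof -
  obtain T x y z u v where *: "trajectory T x y z u v" "x T = a" "y T = b" "z T = c" "l = control_length T u v"
    using assms unfolding lengths_to_iff by blast
  interpret trajectory T x y z u v by fact
  have "trajectory T (\<lambda>t. k * x t) (\<lambda>t. k * y t) (\<lambda>t. k ^ 3 * z t) (\<lambda>t. k * u t) (\<lambda>t. k * v t)"
  proof
    note [measurable] = meas_u meas_v
    show "(\<lambda>t. k * u t) \<in> borel_measurable (lebesgue_on {0..T})"
      "(\<lambda>t. k * v t) \<in> borel_measurable (lebesgue_on {0..T})" by measurable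
    obtain B where B: "\<And>t. t \<in> {0..T} \<Longrightarrow> v t \<le> B" using bounded_v by blast
    show "\<exists>B. \<forall>t\<in>{0..T}. k * v t \<le> B"
      using B assms(2) by (intro exI[of _ "k * B"]) auto
    show "\<bar>k * u t\<bar> \<le> k * v t" if "t \<in> {0..T}" for t
      using causal[OF that] assms(2) by (simp add: abs_mult)
    obtain N where N: "negligible N"
      "\<And>t. t \<in> {0..T} - N \<Longrightarrow> (x has_real_derivative u t) (at t within {0..T})"
      "\<And>t. t \<in> {0..T} - N \<Longrightarrow> (y has_real_derivative v t) (at t within {0..T})"
      "\<And>t. t \<in> {0..T} - N \<Longrightarrow> (z has_real_derivative (x t)\<^sup>2 / 2 * v t) (at t within {0..T})"
      using dynamics by blast
    have "((\<lambda>t. k ^ 3 * z t) has_real_derivative (k * x t)\<^sup>2 / 2 * (k * v t)) (at t within {0..T})"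
      if "t \<in> {0..T} - N" for t
      using DERIV_cmult[OF N(4)[OF that], of "k ^ 3"]
      by (simp add: power_mult_distrib power3_eq_cube power2_eq_square mult_ac)
    then show "\<exists>N. negligible N \<and> (\<forall>t\<in>{0..T} - N.
          ((\<lambda>t. k * x t) has_real_derivative k * u t) (at t within {0..T}) \<and>
          ((\<lambda>t. k * y t) has_real_derivative k * v t) (at t within {0..T}) \<and>
          ((\<lambda>t. k ^ 3 * z t) has_real_derivative (k * x t)\<^sup>2 / 2 * (k * v t)) (at t within {0..T}))"
      using N(1) DERIV_cmult[OF N(2), of _ k] DERIV_cmult[OF N(3), of _ k] by blast
  qed (use T_nonneg start in \<open>auto intro!: lipschitz_fun_intros lip_x lip_y lip_z\<close>)
  moreover have "control_length T (\<lambda>t. k * u t) (\<lambda>t. k * v t) = k * control_length T u v"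
  proof -
    have "sqrt ((k * v t)\<^sup>2 - (k * u t)\<^sup>2) = k * sqrt ((v t)\<^sup>2 - (u t)\<^sup>2)" for t
      using assms(2) by (simp add: power_mult_distrib right_diff_distrib[symmetric] real_sqrt_mult)
    then show ?thesis unfolding control_length_def by simp
  qed
  ultimately show ?thesis unfolding lengths_to_iff using * by metis
qed

lemma lengths_to_reflect:
  assumes "l \<in> lengths_to (a, b, c)"
  shows "l \<in> lengths_to (- a, b, c)"
proof -
  obtain T x y z u v where *: "trajectory T x y z u v" "x T = a" "y T = b" "z T = c" "l = control_length T u v"
    using assms unfolding lengths_to_iff by blast
  interpret trajectory T x y z u v by fact
  have "trajectory T (\<lambda>t. - x t) y z (\<lambda>t. - u t) v"
  proof
    note [measurable] = meas_u meas_v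
    show "(\<lambda>t. - u t) \<in> borel_measurable (lebesgue_on {0..T})" by measurable
    show "\<exists>N. negligible N \<and> (\<forall>t\<in>{0..T} - N.
          ((\<lambda>t. - x t) has_real_derivative - u t) (at t within {0..T}) \<and>
          (y has_real_derivative v t) (at t within {0..T}) \<and>
          (z has_real_derivative (- x t)\<^sup>2 / 2 * v t) (at t within {0..T}))"
      using dynamics DERIV_minus by (simp only: power2_minus) blast
  qed (use T_nonneg start causal bounded_v meas_v in \<open>auto intro!: lipschitz_fun_intros lip_x lip_y lip_z\<close>)
  moreover have "control_length T (\<lambda>t. - u t) v = control_length T u v"
    unfolding control_length_def by simp
  ultimately show ?thesis unfolding lengths_to_iff using * by metis
qed

section \<open>Upper bounds for the length by calibration\<close>

text \<open>
  The weighted inequality of arithmetic and geometric means that bounds the length element in both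
  calibrations, with \<open>p = v - u\<close> and \<open>s = v + u\<close>.
\<close>

lemma sqrt_mult_le_weighted_sum:
  fixes p s \<alpha> \<beta> :: real
  assumes "0 \<le> p" "0 \<le> s" "0 \<le> \<alpha>" "0 \<le> \<beta>" "1 \<le> \<alpha> * \<beta>"
  shows "sqrt (p * s) \<le> (\<alpha> * p + \<beta> * s) / 2"
proof -
  have "4 * (p * s) \<le> 4 * ((\<alpha> * \<beta>) * (p * s))"
    using mult_right_mono[OF assms(5), of "p * s"] assms by simp
  also have "\<dots> = (\<alpha> * p + \<beta> * s)\<^sup>2 - (\<alpha> * p - \<beta> * s)\<^sup>2"
    by (simp add: power2_eq_square algebra_simps)
  also have "\<dots> \<le> (\<alpha> * p + \<beta> * s)\<^sup>2" by simp
  finally have "p * s \<le> ((\<alpha> * p + \<beta> * s) / 2)\<^sup>2" by (simp add: power_divide)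
  then show ?thesis using assms by (intro real_le_lsqrt) auto
qed

context trajectory
begin

lemma v_nonneg: "t \<in> {0..T} \<Longrightarrow> 0 \<le> v t"
  using causal[of t] by linarith

lemma causal_square: "t \<in> {0..T} \<Longrightarrow> (u t)\<^sup>2 \<le> (v t)\<^sup>2"
  using power_mono[OF causal, of t 2] by simp

lemma has_integral_control_length:
  "((\<lambda>t. sqrt ((v t)\<^sup>2 - (u t)\<^sup>2)) has_integral control_length T u v) {0..T}"
proof -
  obtain B where B: "\<And>t. t \<in> {0..T} \<Longrightarrow> v t \<le> B" using bounded_v by blast
  note [measurable] = meas_u meas_v
  have "integrable (lebesgue_on {0..T}) (\<lambda>t. sqrt ((v t)\<^sup>2 - (u t)\<^sup>2))"
  proof (rule integrable_bounded_on_Icc[where B = B])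
    show "(\<lambda>t. sqrt ((v t)\<^sup>2 - (u t)\<^sup>2)) \<in> borel_measurable (lebesgue_on {0..T})"
      by measurable
    fix t assume t: "t \<in> {0..T}"
    have "(u t)\<^sup>2 \<le> (v t)\<^sup>2" by (rule causal_square[OF t])
    moreover have "sqrt ((v t)\<^sup>2 - (u t)\<^sup>2) \<le> sqrt ((v t)\<^sup>2)"
      by (rule real_sqrt_le_mono) simp
    ultimately show "\<bar>sqrt ((v t)\<^sup>2 - (u t)\<^sup>2)\<bar> \<le> B"
      using B[OF t] v_nonneg[OF t] by simp
  qed
  then show ?thesis unfolding control_length_def
    by (intro has_integral_integral_lebesgue_on) auto
qed

lemma control_length_nonneg: "0 \<le> control_length T u v"
  by (rule has_integral_nonneg[OF has_integral_control_length])
     (use causal_square in auto)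

text \<open>
  Upper bounds for the length come from functions \<open>\<Phi>\<close> whose growth dominates the length element.
\<close>

lemma control_length_calibration:
  assumes "lipschitz_fun {0..T} \<Phi>" "negligible N"
    and "\<And>t. t \<in> {0..T} - N \<Longrightarrow> (\<Phi> has_real_derivative D t) (at t within {0..T})"
    and "\<And>t. t \<in> {0..T} - N \<Longrightarrow> sqrt ((v t)\<^sup>2 - (u t)\<^sup>2) \<le> D t"
  shows "control_length T u v \<le> \<Phi> T - \<Phi> 0"
  by (rule lipschitz_fun_increase[OF assms(1) T_nonneg assms(2,3) has_integral_control_length assms(4)])

text \<open>
  Both \<open>y - x\<close> and \<open>y + x\<close> are nondecreasing, so \<open>x\<close> is a function of \<open>y\<close> of slope at most 1.
\<close>

lemma abs_x_increment_le:
  assumes "s \<in> {0..T}" "t \<in> {0..T}" "s \<le> t"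
  shows "\<bar>x t - x s\<bar> \<le> y t - y s"
proof -
  obtain N where N: "negligible N"
    "\<And>t. t \<in> {0..T} - N \<Longrightarrow> (x has_real_derivative u t) (at t within {0..T})"
    "\<And>t. t \<in> {0..T} - N \<Longrightarrow> (y has_real_derivative v t) (at t within {0..T})"
    using dynamics by blast
  have sub: "{s..t} \<subseteq> {0..T}" using assms by auto
  have "y s - x s \<le> y t - x t"
  proof (rule lipschitz_fun_mono[where \<Phi> = "\<lambda>r. y r - x r" and N = N and D = "\<lambda>r. v r - u r"])
    show "lipschitz_fun {s..t} (\<lambda>r. y r - x r)"
      by (rule lipschitz_fun_subset[OF lipschitz_fun_diff[OF lip_y lip_x] sub])
    show "((\<lambda>r. y r - x r) has_real_derivative v r - u r) (at r within {s..t})" if "r \<in> {s..t} - N" for r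
      using DERIV_subset[OF DERIV_diff[OF N(3,2)] sub] that sub by blast
    show "0 \<le> v r - u r" if "r \<in> {s..t} - N" for r
      using causal[of r] that sub by auto
  qed (use assms N in auto)
  moreover have "y s + x s \<le> y t + x t"
  proof (rule lipschitz_fun_mono[where \<Phi> = "\<lambda>r. y r + x r" and N = N and D = "\<lambda>r. v r + u r"])
    show "lipschitz_fun {s..t} (\<lambda>r. y r + x r)"
      by (rule lipschitz_fun_subset[OF lipschitz_fun_add[OF lip_y lip_x] sub])
    show "((\<lambda>r. y r + x r) has_real_derivative v r + u r) (at r within {s..t})" if "r \<in> {s..t} - N" for r
      using DERIV_subset[OF DERIV_add[OF N(3,2)] sub] that sub by blast
    show "0 \<le> v r + u r" if "r \<in> {s..t} - N" for r
      using causal[of r] that sub by auto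
  qed (use assms N in auto)
  ultimately show ?thesis by linarith
qed

lemma y_mono: "s \<in> {0..T} \<Longrightarrow> t \<in> {0..T} \<Longrightarrow> s \<le> t \<Longrightarrow> y s \<le> y t"
  using abs_x_increment_le[of s t] by linarith

lemma abs_x_le_y: "t \<in> {0..T} \<Longrightarrow> \<bar>x t\<bar> \<le> y t"
  using abs_x_increment_le[of 0 t] start T_nonneg by simp

lemma control_length_le_y: "control_length T u v \<le> y T"
proof -
  obtain N where N: "negligible N"
    "\<And>t. t \<in> {0..T} - N \<Longrightarrow> (y has_real_derivative v t) (at t within {0..T})"
    using dynamics by blast
  have "control_length T u v \<le> y T - y 0"
  proof (rule control_length_calibration[OF lip_y N])
    fix t assume t: "t \<in> {0..T} - N"
    have "sqrt ((v t)\<^sup>2 - (u t)\<^sup>2) \<le> sqrt ((v t)\<^sup>2)"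
      by (rule real_sqrt_le_mono) simp
    then show "sqrt ((v t)\<^sup>2 - (u t)\<^sup>2) \<le> v t" using v_nonneg[of t] t by simp
  qed
  then show ?thesis using start by simp
qed

text \<open>
  The functions \<open>z - x\<^sup>3 / 6\<close> and \<open>z + x\<^sup>3 / 6\<close> have the derivatives \<open>x\<^sup>2 (v - u) / 2\<close> and \<open>x\<^sup>2 (v + u) / 2\<close>.
\<close>

lemma abs_x_cube_le_z: "\<bar>x T\<bar> ^ 3 / 6 \<le> z T"
proof -
  obtain N where N: "negligible N"
    "\<And>t. t \<in> {0..T} - N \<Longrightarrow> (x has_real_derivative u t) (at t within {0..T})"
    "\<And>t. t \<in> {0..T} - N \<Longrightarrow> (z has_real_derivative (x t)\<^sup>2 / 2 * v t) (at t within {0..T})"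
    using dynamics by blast
  have "z 0 - x 0 ^ 3 / 6 \<le> z T - x T ^ 3 / 6"
  proof (rule lipschitz_fun_mono[where \<Phi> = "\<lambda>t. z t - x t ^ 3 / 6" and N = N and D = "\<lambda>t. (x t)\<^sup>2 / 2 * (v t - u t)"])
    show "lipschitz_fun {0..T} (\<lambda>t. z t - x t ^ 3 / 6)"
      by (intro lipschitz_fun_intros lip_x lip_z)
    show "((\<lambda>t. z t - x t ^ 3 / 6) has_real_derivative (x t)\<^sup>2 / 2 * (v t - u t)) (at t within {0..T})"
      if t: "t \<in> {0..T} - N" for t
      by (auto intro!: derivative_eq_intros N(2)[OF t] N(3)[OF t] simp: algebra_simps)
    show "0 \<le> (x t)\<^sup>2 / 2 * (v t - u t)" if "t \<in> {0..T} - N" for t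
      using causal[of t] that by (intro mult_nonneg_nonneg) auto
  qed (use T_nonneg N in auto)
  moreover have "z 0 + x 0 ^ 3 / 6 \<le> z T + x T ^ 3 / 6"
  proof (rule lipschitz_fun_mono[where \<Phi> = "\<lambda>t. z t + x t ^ 3 / 6" and N = N and D = "\<lambda>t. (x t)\<^sup>2 / 2 * (v t + u t)"])
    show "lipschitz_fun {0..T} (\<lambda>t. z t + x t ^ 3 / 6)"
      by (intro lipschitz_fun_intros lip_x lip_z)
    show "((\<lambda>t. z t + x t ^ 3 / 6) has_real_derivative (x t)\<^sup>2 / 2 * (v t + u t)) (at t within {0..T})"
      if t: "t \<in> {0..T} - N" for t
      by (auto intro!: derivative_eq_intros N(2)[OF t] N(3)[OF t] simp: algebra_simps)
    show "0 \<le> (x t)\<^sup>2 / 2 * (v t + u t)" if "t \<in> {0..T} - N" for t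
      using causal[of t] that by (intro mult_nonneg_nonneg) auto
  qed (use T_nonneg N in auto)
  ultimately show ?thesis using start by (auto simp: abs_if)
qed

text \<open>
  A trajectory that nearly minimizes \<open>z\<close> stays near \<open>x = 0\<close> and then moves almost at slope 1, so its
  length can hardly exceed \<open>y - x\<close>. The term \<open>2 s\<^sup>2 (z - x\<^sup>3 / 6)\<close> charges for every deviation from slope
  1 away from \<open>x = 0\<close>, which pays for the credit \<open>x - arctan (s x) / s\<close>: this is \<open>x\<close> up to \<open>2 / s\<close>, and
  its derivative in \<open>x\<close> is \<open>w / (1 + w)\<close> with \<open>w = s\<^sup>2 x\<^sup>2\<close>.
\<close>

lemma control_length_le_near_bottom:
  assumes s: "0 < s"
  shows "control_length T u v \<le> y T - x T + 2 * s\<^sup>2 * (z T - x T ^ 3 / 6) + 2 / s"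
proof -
  obtain N where N: "negligible N"
    "\<And>t. t \<in> {0..T} - N \<Longrightarrow> (x has_real_derivative u t) (at t within {0..T})"
    "\<And>t. t \<in> {0..T} - N \<Longrightarrow> (y has_real_derivative v t) (at t within {0..T})"
    "\<And>t. t \<in> {0..T} - N \<Longrightarrow> (z has_real_derivative (x t)\<^sup>2 / 2 * v t) (at t within {0..T})"
    using dynamics by blast
  define A where "A t = arctan (s * x t) / s" for t
  define \<Phi> where "\<Phi> t = y t + 2 * s\<^sup>2 * z t - s\<^sup>2 * x t ^ 3 / 3 - x t + A t" for t
  define w where "w t = s\<^sup>2 * (x t)\<^sup>2" for t
  have w0: "0 \<le> w t" for t by (simp add: w_def)
  have "control_length T u v \<le> \<Phi> T - \<Phi> 0"
  proof (rule control_length_calibration[OF _ N(1)])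
    show "lipschitz_fun {0..T} \<Phi>" unfolding \<Phi>_def A_def
      by (intro lipschitz_fun_intros lip_x lip_y lip_z)
    fix t assume t: "t \<in> {0..T} - N"
    have "((\<lambda>t. arctan (s * x t) / s) has_real_derivative (inverse (1 + (s * x t)\<^sup>2) * (s * u t)) / s)
        (at t within {0..T})"
      by (intro DERIV_cdivide DERIV_chain2[OF DERIV_arctan] DERIV_cmult N(2)[OF t])
    then have A: "(A has_real_derivative u t / (1 + w t)) (at t within {0..T})"
      using s by (simp add: A_def[abs_def] w_def power_mult_distrib inverse_eq_divide)
    show "(\<Phi> has_real_derivative (1 + w t) * v t - w t * u t - u t + u t / (1 + w t)) (at t within {0..T})"
      unfolding \<Phi>_def
      by (auto intro!: derivative_eq_intros A N(2)[OF t] N(3)[OF t] N(4)[OF t]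
          simp: w_def algebra_simps)
    have vu: "0 \<le> v t - u t" "0 \<le> v t + u t" using causal[of t] t by auto
    have pos: "0 < 1 + w t" using w0[of t] by linarith
    have "sqrt ((v t)\<^sup>2 - (u t)\<^sup>2) = sqrt ((v t - u t) * (v t + u t))"
      by (simp add: power2_eq_square algebra_simps)
    also have "\<dots> \<le> ((2 + 2 * w t - 1 / (1 + w t)) * (v t - u t) + 1 / (1 + w t) * (v t + u t)) / 2"
    proof (rule sqrt_mult_le_weighted_sum[OF vu])
      have "1 / (1 + w t) \<le> 1" using w0[of t] by simp
      then show "0 \<le> 2 + 2 * w t - 1 / (1 + w t)" using w0[of t] by linarith
      have "1 / (1 + w t) * (1 / (1 + w t)) \<le> 1"
        using w0[of t] by (intro mult_le_one) auto
      moreover have "(2 + 2 * w t - g) * g = 2 * ((1 + w t) * g) - g * g" for g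
        by (simp add: algebra_simps)
      from this[of "1 / (1 + w t)"]
      have "(2 + 2 * w t - 1 / (1 + w t)) * (1 / (1 + w t)) =
        2 * ((1 + w t) * (1 / (1 + w t))) - 1 / (1 + w t) * (1 / (1 + w t))" .
      moreover have "(1 + w t) * (1 / (1 + w t)) = 1" using pos by simp
      ultimately show "1 \<le> (2 + 2 * w t - 1 / (1 + w t)) * (1 / (1 + w t))" by linarith
    qed (use pos in auto)
    also have "\<dots> = (1 + w t) * v t - w t * u t - u t + u t / (1 + w t)"
    proof -
      have "((2 + 2 * w t - g) * (v t - u t) + g * (v t + u t)) / 2
        = (1 + w t) * v t - w t * u t - u t + g * u t" for g
        by (simp add: field_simps)
      from this[of "1 / (1 + w t)"] show ?thesis by simp
    qed
    finally show "sqrt ((v t)\<^sup>2 - (u t)\<^sup>2) \<le> (1 + w t) * v t - w t * u t - u t + u t / (1 + w t)" .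
  qed
  also have "\<Phi> T - \<Phi> 0 = y T - x T + 2 * s\<^sup>2 * (z T - x T ^ 3 / 6) + arctan (s * x T) / s"
    unfolding \<Phi>_def A_def using start by (simp add: algebra_simps)
  also have "arctan (s * x T) / s \<le> 2 / s"
    using arctan_ubound[of "s * x T"] pi_less_4 s by (intro divide_right_mono) auto
  finally show ?thesis by simp
qed

text \<open>
  For \<open>x \<ge> 0\<close> the greatest height at \<open>(x, y)\<close> is \<open>((y + x)\<^sup>3 / 4 - x\<^sup>3) / 6\<close>: it is reached by moving
  out at slope 1 up to \<open>(y + x) / 2\<close> and back at slope -1. The gap to it never decreases along a trajectory
  with \<open>x \<ge> 0\<close>: height lost by a wrong choice of the slope cannot be regained later.
\<close>

definition top_gap :: "real \<Rightarrow> real" where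
  "top_gap t = ((y t + x t) ^ 3 / 4 - x t ^ 3) / 6 - z t"

lemma lip_top_gap: "lipschitz_fun {0..T} top_gap"
  unfolding top_gap_def by (intro lipschitz_fun_intros lip_x lip_y lip_z)

lemma top_gap_dynamics:
  "\<exists>N. negligible N \<and> (\<forall>t\<in>{0..T} - N.
      (x has_real_derivative u t) (at t within {0..T}) \<and>
      (y has_real_derivative v t) (at t within {0..T}) \<and>
      (top_gap has_real_derivative (y t - x t) * (y t + 3 * x t) / 8 * (v t + u t)) (at t within {0..T}))"
proof -
  obtain N where N: "negligible N"
    "\<And>t. t \<in> {0..T} - N \<Longrightarrow> (x has_real_derivative u t) (at t within {0..T})"
    "\<And>t. t \<in> {0..T} - N \<Longrightarrow> (y has_real_derivative v t) (at t within {0..T})"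
    "\<And>t. t \<in> {0..T} - N \<Longrightarrow> (z has_real_derivative (x t)\<^sup>2 / 2 * v t) (at t within {0..T})"
    using dynamics by blast
  have "(top_gap has_real_derivative (y t - x t) * (y t + 3 * x t) / 8 * (v t + u t)) (at t within {0..T})"
    if t: "t \<in> {0..T} - N" for t
    unfolding top_gap_def
    by (auto intro!: derivative_eq_intros N(2)[OF t] N(3)[OF t] N(4)[OF t]
        simp: field_simps power2_eq_square)
  then show ?thesis using N by blast
qed

lemma top_gap_nonneg:
  assumes pos: "\<And>t. t \<in> {0..T} \<Longrightarrow> 0 \<le> x t"
  shows "0 \<le> top_gap T"
proof -
  obtain N where N: "negligible N" "\<And>t. t \<in> {0..T} - N \<Longrightarrow>
      (top_gap has_real_derivative (y t - x t) * (y t + 3 * x t) / 8 * (v t + u t)) (at t within {0..T})"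
    using top_gap_dynamics by blast
  have "top_gap 0 \<le> top_gap T"
  proof (rule lipschitz_fun_mono[OF lip_top_gap T_nonneg N])
    show "0 \<le> (y t - x t) * (y t + 3 * x t) / 8 * (v t + u t)" if "t \<in> {0..T} - N" for t
      using causal[of t] abs_x_le_y[of t] pos[of t] that by auto
  qed auto
  then show ?thesis using start by (simp add: top_gap_def)
qed

text \<open>
  Moving at a slope other than -1 while \<open>x < y\<close> increases the gap, at the rate
  \<open>(y - x) (y + 3 x) (v + u) / 8\<close>. The weight \<open>\<beta>\<close> of \<open>v + u\<close> is therefore paid for by the gap, up to
  the small constant \<open>e\<close>. The weight \<open>\<alpha>\<close> of \<open>v - u\<close> is \<open>1 / (e (1 + c\<^sup>2 m\<^sup>2))\<close> with
  \<open>m = y - x\<close>, whose integral over \<open>m \<ge> 0\<close> is small when \<open>c e\<close> is large.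
\<close>

lemma control_length_le_near_top:
  assumes pos: "\<And>t. t \<in> {0..T} \<Longrightarrow> 0 \<le> x t" and e: "0 < e" and c: "0 < c"
  shows "control_length T u v \<le> e * y T + 4 * c\<^sup>2 * e * top_gap T + 1 / (c * e)"
proof -
  obtain N where N: "negligible N"
    "\<And>t. t \<in> {0..T} - N \<Longrightarrow> (x has_real_derivative u t) (at t within {0..T})"
    "\<And>t. t \<in> {0..T} - N \<Longrightarrow> (y has_real_derivative v t) (at t within {0..T})"
    "\<And>t. t \<in> {0..T} - N \<Longrightarrow>
      (top_gap has_real_derivative (y t - x t) * (y t + 3 * x t) / 8 * (v t + u t)) (at t within {0..T})"
    using top_gap_dynamics by blast
  define \<Phi> where "\<Phi> t = (e * (y t + x t) + 8 * c\<^sup>2 * e * top_gap t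
    + arctan (c * (y t - x t)) / (c * e)) / 2" for t
  define \<alpha> where "\<alpha> t = 1 / (e * (1 + c\<^sup>2 * (y t - x t)\<^sup>2))" for t
  define \<beta> where "\<beta> t = e * (1 + c\<^sup>2 * ((y t - x t) * (y t + 3 * x t)))" for t
  have "control_length T u v \<le> \<Phi> T - \<Phi> 0"
  proof (rule control_length_calibration[OF _ N(1)])
    show "lipschitz_fun {0..T} \<Phi>" unfolding \<Phi>_def
      by (intro lipschitz_fun_intros lip_x lip_y lip_top_gap)
    fix t assume t: "t \<in> {0..T} - N"
    have "1 + c\<^sup>2 * (y t - x t)\<^sup>2 \<noteq> 0"
      by (metis add_pos_nonneg less_irrefl mult_nonneg_nonneg zero_le_power2 zero_less_one)
    then show "(\<Phi> has_real_derivative (\<alpha> t * (v t - u t) + \<beta> t * (v t + u t)) / 2) (at t within {0..T})"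
      unfolding \<Phi>_def \<alpha>_def \<beta>_def using e c
      by (auto intro!: derivative_eq_intros N(2)[OF t] N(3)[OF t] N(4)[OF t]
          simp: power_mult_distrib inverse_eq_divide divide_simps)
         (simp add: algebra_simps)
    have vu: "0 \<le> v t - u t" "0 \<le> v t + u t" using causal[of t] t by auto
    have xy: "0 \<le> y t - x t" "0 \<le> x t" using abs_x_le_y[of t] pos[of t] t by auto
    have "1 + c\<^sup>2 * (y t - x t)\<^sup>2 \<le> 1 + c\<^sup>2 * ((y t - x t) * (y t + 3 * x t))"
      unfolding power2_eq_square[of "y t - x t"] using xy
      by (intro add_left_mono mult_left_mono) auto
    then have ab: "1 \<le> \<alpha> t * \<beta> t"
      unfolding \<alpha>_def \<beta>_def using e by (simp add: divide_simps add_pos_nonneg)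
    have "sqrt ((v t)\<^sup>2 - (u t)\<^sup>2) = sqrt ((v t - u t) * (v t + u t))"
      by (simp add: power2_eq_square algebra_simps)
    also have "\<dots> \<le> (\<alpha> t * (v t - u t) + \<beta> t * (v t + u t)) / 2"
      by (rule sqrt_mult_le_weighted_sum[OF vu _ _ ab])
         (use e xy in \<open>auto simp: \<alpha>_def \<beta>_def\<close>)
    finally show "sqrt ((v t)\<^sup>2 - (u t)\<^sup>2) \<le> (\<alpha> t * (v t - u t) + \<beta> t * (v t + u t)) / 2" .
  qed
  also have "\<Phi> T - \<Phi> 0 = (e * (y T + x T) + 8 * c\<^sup>2 * e * top_gap T + arctan (c * (y T - x T)) / (c * e)) / 2"
    unfolding \<Phi>_def top_gap_def using start by simp
  also have "\<dots> \<le> (e * (2 * y T) + 8 * c\<^sup>2 * e * top_gap T + 2 / (c * e)) / 2"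
    using arctan_ubound[of "c * (y T - x T)"] pi_less_4 e c abs_x_le_y[of T] T_nonneg
    by (intro divide_right_mono add_mono mult_left_mono) auto
  finally show ?thesis by simp
qed

lemma control_length_eq_0_at_top:
  assumes pos: "\<And>t. t \<in> {0..T} \<Longrightarrow> 0 \<le> x t" and top: "top_gap T = 0"
  shows "control_length T u v = 0"
proof -
  have "control_length T u v \<le> 0 + e" if e: "0 < e" for e
  proof -
    \<comment> \<open>With zero gap the bound holds for the weights \<open>e = d\<close> and \<open>c = 1 /
      d\<^sup>2\<close>, and is then \<open>d (y T + 1)\<close>.\<close>
    define d where "d = e / (y T + 1)"
    have yT: "0 \<le> y T" using abs_x_le_y[of T] T_nonneg by simp
    then have d: "0 < d" using e by (simp add: d_def)
    have "control_length T u v \<le> d * y T + 4 * (1 / d\<^sup>2)\<^sup>2 * d * top_gap T + 1 / (1 / d\<^sup>2 * d)"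
      by (rule control_length_le_near_top[OF pos d]) (use d in auto)
    also have "\<dots> = d * (y T + 1)" using d top by (simp add: power2_eq_square algebra_simps)
    also have "\<dots> = e" using yT by (simp add: d_def)
    finally show ?thesis by simp
  qed
  then have "control_length T u v \<le> 0" by (rule field_le_epsilon)
  then show ?thesis using control_length_nonneg by simp
qed

end

section \<open>Continuing a trajectory along a lightlike line\<close>

lemma has_real_derivative_glue:
  fixes f g :: "real \<Rightarrow> real"
  assumes "t \<in> {a..c}" "t \<noteq> b"
    and f: "t < b \<Longrightarrow> (f has_real_derivative d) (at t within {a..b})"
    and g: "b < t \<Longrightarrow> (g has_real_derivative d) (at t)"
  shows "((\<lambda>s. if s \<le> b then f s else g s) has_real_derivative d) (at t within {a..c})"
proof (cases "t < b")
  case True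
  have "(f has_real_derivative d) (at t within {a..c} \<inter> {..<b})"
    by (rule DERIV_subset[OF f[OF True]]) auto
  moreover have "at t within {a..c} \<inter> {..<b} = at t within {a..c}"
    by (rule at_within_nhd[of _ "{..<b}"]) (use True in auto)
  ultimately have "(f has_real_derivative d) (at t within {a..c})" by simp
  then show ?thesis
    by (rule has_field_derivative_transform_within[where d = "b - t"])
       (use True assms(1) in \<open>auto simp: dist_real_def\<close>)
next
  case False
  with assms(2) have "b < t" by simp
  have "((\<lambda>s. if s \<le> b then f s else g s) has_real_derivative d) (at t)"
    by (rule has_field_derivative_transform_within_open[OF g[OF \<open>b < t\<close>], of "{b<..}"])
       (use \<open>b < t\<close> in auto)
  then show ?thesis by (rule has_field_derivative_at_within)
qed

lemma borel_measurable_glue: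
  fixes f :: "real \<Rightarrow> real"
  assumes "f \<in> borel_measurable (lebesgue_on {a..b})"
  shows "(\<lambda>t. if t \<le> b then f t else k) \<in> borel_measurable (lebesgue_on {a..c})"
proof -
  have *: "(\<lambda>t. if t \<in> {a..b} then f t else 0) \<in> borel_measurable lebesgue"
    by (rule borel_measurable_if_I[OF assms]) auto
  have "(\<lambda>t. if t \<in> {a..b} then (if t \<in> {a..b} then f t else 0) else k) \<in> borel_measurable lebesgue"
    by (rule measurable_If_set[OF *]) auto
  then have "(\<lambda>t. if t \<in> {a..b} then (if t \<in> {a..b} then f t else 0) else k) \<in> borel_measurable (lebesgue_on {a..c})"
    by (rule measurable_restrict_space1)
  then show ?thesis
    by (rule measurable_cong[THEN iffD1, rotated]) auto
qed

text \<open>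
  Along a segment of slope 1 or -1 the length element vanishes.
\<close>

lemma (in trajectory) append_lightlike_segment:
  assumes \<alpha>: "\<alpha>\<^sup>2 = 1" and r: "0 \<le> r"
  shows "control_length T u v \<in>
    lengths_to (x T + \<alpha> * r, y T + r, z T + \<alpha> * ((x T + \<alpha> * r) ^ 3 - x T ^ 3) / 6)"
proof -
  define X where "X t = (if t \<le> T then x t else x T + \<alpha> * (t - T))" for t
  define Y where "Y t = (if t \<le> T then y t else y T + (t - T))" for t
  define Z where "Z t = (if t \<le> T then z t else z T + \<alpha> * ((x T + \<alpha> * (t - T)) ^ 3 - x T ^ 3) / 6)" for t
  define U where "U t = (if t \<le> T then u t else \<alpha>)" for t
  define V where "V t = (if t \<le> T then v t else 1)" for t
  have a1: "\<bar>\<alpha>\<bar> = 1" using \<alpha> by (simp add: power2_eq_1_iff) linarith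
  have tr: "trajectory (T + r) X Y Z U V"
  proof
    show "0 \<le> T + r" using T_nonneg r by simp
    show "lipschitz_fun {0..T + r} X" unfolding X_def
      by (rule lipschitz_fun_glue[OF lip_x]; (intro lipschitz_fun_intros)?) simp_all
    show "lipschitz_fun {0..T + r} Y" unfolding Y_def
      by (rule lipschitz_fun_glue[OF lip_y]; (intro lipschitz_fun_intros)?) simp_all
    show "lipschitz_fun {0..T + r} Z" unfolding Z_def
      by (rule lipschitz_fun_glue[OF lip_z]; (intro lipschitz_fun_intros)?) simp_all
    show "U \<in> borel_measurable (lebesgue_on {0..T + r})" unfolding U_def
      by (rule borel_measurable_glue[OF meas_u])
    show "V \<in> borel_measurable (lebesgue_on {0..T + r})" unfolding V_def
      by (rule borel_measurable_glue[OF meas_v])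
    obtain B where "\<And>t. t \<in> {0..T} \<Longrightarrow> v t \<le> B" using bounded_v by blast
    then show "\<exists>B. \<forall>t\<in>{0..T + r}. V t \<le> B"
      by (intro exI[of _ "max 1 B"]) (auto simp: V_def le_max_iff_disj)
    show "\<bar>U t\<bar> \<le> V t" if "t \<in> {0..T + r}" for t
      using causal[of t] that a1 by (auto simp: U_def V_def)
    show "X 0 = 0" "Y 0 = 0" "Z 0 = 0" using start T_nonneg by (auto simp: X_def Y_def Z_def)
    obtain N where N: "negligible N"
      "\<And>t. t \<in> {0..T} - N \<Longrightarrow> (x has_real_derivative u t) (at t within {0..T})"
      "\<And>t. t \<in> {0..T} - N \<Longrightarrow> (y has_real_derivative v t) (at t within {0..T})"
      "\<And>t. t \<in> {0..T} - N \<Longrightarrow> (z has_real_derivative (x t)\<^sup>2 / 2 * v t) (at t within {0..T})"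
      using dynamics by blast
    have "(X has_real_derivative U t) (at t within {0..T + r}) \<and>
          (Y has_real_derivative V t) (at t within {0..T + r}) \<and>
          (Z has_real_derivative (X t)\<^sup>2 / 2 * V t) (at t within {0..T + r})"
      if t: "t \<in> {0..T + r} - (N \<union> {T})" for t
      unfolding X_def[abs_def] Y_def[abs_def] Z_def[abs_def]
    proof (intro conjI has_real_derivative_glue)
      show "((\<lambda>t. z T + \<alpha> * ((x T + \<alpha> * (t - T)) ^ 3 - x T ^ 3) / 6) has_real_derivative
          (if t \<le> T then x t else x T + \<alpha> * (t - T))\<^sup>2 / 2 * V t) (at t)" if "T < t"
      proof -
        have "((\<lambda>t. z T + \<alpha> * ((x T + \<alpha> * (t - T)) ^ 3 - x T ^ 3) / 6) has_real_derivative
          \<alpha> * (3 * (x T + \<alpha> * (t - T))\<^sup>2 * \<alpha>) / 6) (at t)"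
          by (auto intro!: derivative_eq_intros)
        moreover have "\<alpha> * (3 * (x T + \<alpha> * (t - T))\<^sup>2 * \<alpha>) / 6 = \<alpha>\<^sup>2 * ((x T + \<alpha> * (t - T))\<^sup>2 / 2)"
          by (simp add: power2_eq_square)
        ultimately show ?thesis using that \<alpha> by (simp add: V_def)
      qed
    qed (use t N in \<open>auto simp: U_def V_def intro!: derivative_eq_intros\<close>)
    then show "\<exists>N. negligible N \<and> (\<forall>t\<in>{0..T + r} - N.
          (X has_real_derivative U t) (at t within {0..T + r}) \<and>
          (Y has_real_derivative V t) (at t within {0..T + r}) \<and>
          (Z has_real_derivative (X t)\<^sup>2 / 2 * V t) (at t within {0..T + r}))"
      using N(1) by (intro exI[of _ "N \<union> {T}"]) auto
  qed
  have "((\<lambda>t. if t \<in> {0..T} then sqrt ((v t)\<^sup>2 - (u t)\<^sup>2) else 0) has_integral control_length T u v) {0..T + r}"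
    by (subst has_integral_restrict) (use r has_integral_control_length in auto)
  then have "((\<lambda>t. sqrt ((V t)\<^sup>2 - (U t)\<^sup>2)) has_integral control_length T u v) {0..T + r}"
    by (rule has_integral_eq[rotated]) (auto simp: U_def V_def \<alpha>)
  from has_integral_unique[OF this trajectory.has_integral_control_length[OF tr]]
  have len: "control_length T u v = control_length (T + r) U V" .
  have endpoint: "X (T + r) = x T + \<alpha> * r" "Y (T + r) = y T + r"
    "Z (T + r) = z T + \<alpha> * ((x T + \<alpha> * r) ^ 3 - x T ^ 3) / 6"
    using r by (auto simp: X_def Y_def Z_def)
  show ?thesis unfolding lengths_to_iff using tr len endpoint by blast
qed

lemma lengths_to_append:
  assumes "l \<in> lengths_to (r, b, c)" "0 \<le> r"
  shows "l \<in> lengths_to (0, b + r, c + r ^ 3 / 6)"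
proof -
  obtain T x y z u v where *: "trajectory T x y z u v" "x T = r" "y T = b" "z T = c" "l = control_length T u v"
    using assms unfolding lengths_to_iff by blast
  from trajectory.append_lightlike_segment[OF *(1), of "-1" r] show ?thesis using * assms(2) by simp
qed

text \<open>
  The trajectory waits at \<open>x = 0\<close> for the time \<open>1 - r\<close> and then leaves at slope 1.
\<close>

lemma lengths_to_bottom:
  assumes "0 \<le> r" "r \<le> 1"
  shows "1 - r \<in> lengths_to (r, 1, r ^ 3 / 6)"
proof -
  interpret trajectory "1 - r" "\<lambda>t. 0" "\<lambda>t. t" "\<lambda>t. 0" "\<lambda>t. 0" "\<lambda>t. 1"
  proof
    show "\<exists>N. negligible N \<and> (\<forall>t\<in>{0..1 - r} - N.
      ((\<lambda>t. 0) has_real_derivative 0) (at t within {0..1 - r}) \<and>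
      ((\<lambda>t. t) has_real_derivative 1) (at t within {0..1 - r}) \<and>
      ((\<lambda>t. 0) has_real_derivative 0\<^sup>2 / 2 * 1) (at t within {0..1 - r}))"
      by (intro exI[of _ "{}"]) auto
  qed (use assms in \<open>auto intro!: lipschitz_fun_intros\<close>)
  have "((\<lambda>t. sqrt (1\<^sup>2 - 0\<^sup>2)) has_integral (1 - r)) {0..1 - r}"
    using has_integral_const_real[of "1 :: real" 0 "1 - r"] assms by simp
  then have "control_length (1 - r) (\<lambda>t. 0) (\<lambda>t. 1) = 1 - r"
    by (rule has_integral_unique[OF has_integral_control_length])
  then show ?thesis using append_lightlike_segment[of 1 r] assms by simp
qed

section \<open>Mixing a trajectory with a curve\<close>

text \<open>
  A level set of the monotone function \<open>y\<close> is an interval, so at all but its two end points \<open>y\<close> is locally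
  constant. This takes care of the times at which \<open>y\<close> sits at a value where a function composed with it is
  not differentiable.
\<close>

lemma (in trajectory) level_set_locally_constant:
  "\<exists>F. finite F \<and> (\<forall>t\<in>{0..T} - F. y t = c \<longrightarrow> (\<exists>d>0. \<forall>s\<in>{0..T}. \<bar>s - t\<bar> < d \<longrightarrow> y s = c))"
proof -
  define A where "A = {t \<in> {0..T}. y t = c}"
  have "\<exists>d>0. \<forall>s\<in>{0..T}. \<bar>s - t\<bar> < d \<longrightarrow> y s = c"
    if t: "t \<in> {0..T} - {Inf A, Sup A}" "y t = c" for t
  proof -
    have tA: "t \<in> A" using t by (auto simp: A_def)
    have bdd: "bdd_below A" "bdd_above A" by (auto simp: A_def)
    have "Inf A < t" using cInf_lower[OF tA bdd(1)] t by auto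
    then obtain p where p: "p \<in> A" "p < t" using cInf_less_iff[of A t] tA bdd by blast
    have "t < Sup A" using cSup_upper[OF tA bdd(2)] t by auto
    then obtain q where q: "q \<in> A" "t < q" using less_cSup_iff[of A t] tA bdd by blast
    show ?thesis
    proof (intro exI[of _ "min (t - p) (q - t)"] conjI ballI impI)
      fix s assume s: "s \<in> {0..T}" "\<bar>s - t\<bar> < min (t - p) (q - t)"
      then have "p \<le> s" "s \<le> q" by linarith+
      then have "y p \<le> y s" "y s \<le> y q" using p q s y_mono[of p s] y_mono[of s q] by (auto simp: A_def)
      then show "y s = c" using p q by (auto simp: A_def)
    qed (use p q in auto)
  qed
  then show ?thesis by (intro exI[of _ "{Inf A, Sup A}"]) auto
qed

text \<open>
  The concavity of the length in the variable \<open>x\<^sup>2\<close>. Let \<open>g\<close> be the square of a curve of slope at most 1; as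
  \<open>h\<close> is half the derivative of \<open>g\<close>, this is the condition \<open>h\<^sup>2 \<le> g\<close>. Replacing \<open>x\<^sup>2\<close> by the convex
  combination \<open>(1 - e) x\<^sup>2 + e g(y)\<close> gives a trajectory again, by the Cauchy-Schwarz inequality, and moves
  the end point linearly in the coordinates \<open>(x\<^sup>2, z)\<close>. In the same way the slack \<open>v\<^sup>2 - u\<^sup>2\<close> shrinks at
  most by the factor \<open>1 - e\<close>. Squares also make the new \<open>x\<close> nonnegative whatever the sign of the old one.
\<close>

lemma (in trajectory) mix_with_curve:
  fixes g h :: "real \<Rightarrow> real"
  assumes yT: "y T = 1" and g0: "g 0 = 0" and g_nonneg: "\<And>s. s \<in> {0..1} \<Longrightarrow> 0 \<le> g s"
    and g_lip: "lipschitz_fun {0..1} (\<lambda>s. sqrt (g s))"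
    and h_meas: "h \<in> borel_measurable borel"
    and h_le: "\<And>s. s \<in> {0..1} \<Longrightarrow> (h s)\<^sup>2 \<le> g s"
    and g_pos: "\<And>s. 0 < s \<Longrightarrow> s < 1 \<Longrightarrow> 0 < g s"
    and K: "finite K"
    and g_der: "\<And>s. s \<in> {0<..<1} - K \<Longrightarrow> (g has_real_derivative 2 * h s) (at s)"
    and e: "0 < e" "e \<le> 1"
  shows "\<exists>X Z U. trajectory T X y Z U v \<and> (\<forall>t\<in>{0..T}. 0 \<le> X t) \<and>
    X T = sqrt ((1 - e) * (x T)\<^sup>2 + e * g 1) \<and>
    Z T = (1 - e) * z T + e * integral {0..1} (\<lambda>s. g s / 2) \<and>
    (1 - e) * control_length T u v \<le> control_length T U v"
proof -
  have y01: "y t \<in> {0..1}" if "t \<in> {0..T}" for t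
    using y_mono[of 0 t] y_mono[of t T] that T_nonneg yT start by auto
  have yim: "y ` {0..T} \<subseteq> {0..1}" using y01 by blast
  define R where "R t = (1 - e) * (x t)\<^sup>2 + e * g (y t)" for t
  define X where "X t = sqrt (R t)" for t
  define U where "U t = ((1 - e) * x t * u t + e * h (y t) * v t) / X t" for t
  define G where "G s = integral {0..s} (\<lambda>s. g s / 2)" for s
  define Z where "Z t = (1 - e) * z t + e * G (y t)" for t
  have R0: "0 \<le> R t" if "t \<in> {0..T}" for t
    using g_nonneg[OF y01[OF that]] e by (simp add: R_def)
  have X2: "(X t)\<^sup>2 = R t" if "t \<in> {0..T}" for t using R0[OF that] by (simp add: X_def)
  have g_lip': "lipschitz_fun {0..1} g"
    by (rule lipschitz_fun_cong[OF lipschitz_fun_power[OF g_lip, of 2]]) (simp add: g_nonneg)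
  have lip_X: "lipschitz_fun {0..T} X"
  proof -
    have "lipschitz_fun {0..T} (\<lambda>t. sqrt (g (y t)))"
      by (rule lipschitz_fun_compose[OF lip_y g_lip yim])
    then have "lipschitz_fun {0..T} (\<lambda>t. sqrt ((sqrt (1 - e) * x t)\<^sup>2 + (sqrt e * sqrt (g (y t)))\<^sup>2))"
      by (intro lipschitz_fun_sqrt_sum_squares lipschitz_fun_intros lip_x)
    then show ?thesis
      by (rule lipschitz_fun_cong) (use e g_nonneg y01 in \<open>simp add: X_def R_def power_mult_distrib\<close>)
  qed
  have G_der: "(G has_real_derivative g s / 2) (at s within {0..1})" if "s \<in> {0..1}" for s
    unfolding G_def by (rule integral_has_real_derivative[OF _ that])
      (intro continuous_intros lipschitz_fun_continuous g_lip' | simp)+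
  have lip_G: "lipschitz_fun {0..1} G"
  proof -
    obtain B where B: "0 < B" "\<And>s. s \<in> {0..1} \<Longrightarrow> \<bar>g s\<bar> \<le> B"
      using lipschitz_fun_bounded[OF g_lip'] by metis
    have "B-lipschitz_on {0..1} G"
    proof (rule lipschitz_onI)
      fix p q :: real assume pq: "p \<in> {0..1}" "q \<in> {0..1}"
      have "norm (G p - G q) \<le> B * norm (p - q)"
      proof (rule field_differentiable_bound[OF _ G_der _ pq])
        show "norm (g s / 2) \<le> B" if "s \<in> {0..1}" for s
          using B(1) B(2)[OF that] by simp
      qed auto
      then show "dist (G p) (G q) \<le> B * dist p q" by (simp add: dist_norm)
    qed (use B in simp)
    then show ?thesis unfolding lipschitz_fun_def by blast
  qed
  \<comment> \<open>The Cauchy-Schwarz inequality for the vectors \<open>(a, k)\<close> and \<open>(b, w)\<close> with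
    the weights \<open>1 - e\<close> and \<open>e\<close>.\<close>
  have num: "((1 - e) * a * b + e * k * w)\<^sup>2 \<le> ((1 - e) * a\<^sup>2 + e * m) * ((1 - e) * b\<^sup>2 + e * w\<^sup>2)"
    if "k\<^sup>2 \<le> m" for a b k w m :: real
  proof -
    have "((1 - e) * a\<^sup>2 + e * k\<^sup>2) * ((1 - e) * b\<^sup>2 + e * w\<^sup>2) - ((1 - e) * a * b + e * k * w)\<^sup>2
      = (1 - e) * e * (a * w - k * b)\<^sup>2" by (simp add: power2_eq_square algebra_simps)
    also have "\<dots> \<ge> 0" using e by simp
    finally have "((1 - e) * a * b + e * k * w)\<^sup>2 \<le> ((1 - e) * a\<^sup>2 + e * k\<^sup>2) * ((1 - e) * b\<^sup>2 + e * w\<^sup>2)"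
      by simp
    also have "\<dots> \<le> ((1 - e) * a\<^sup>2 + e * m) * ((1 - e) * b\<^sup>2 + e * w\<^sup>2)"
      using that e by (intro mult_right_mono add_left_mono mult_left_mono) auto
    finally show ?thesis .
  qed
  have U2: "(U t)\<^sup>2 \<le> (1 - e) * (u t)\<^sup>2 + e * (v t)\<^sup>2" if t: "t \<in> {0..T}" for t
  proof (cases "X t = 0")
    case True then show ?thesis using e by (simp add: U_def)
  next
    case False
    then have "0 < R t" using R0[OF t] by (simp add: X_def)
    then show ?thesis
      using num[OF h_le[OF y01[OF t]], of "x t" "u t" "v t"]
      by (simp add: U_def power_divide X2[OF t] R_def[symmetric] divide_le_eq mult.commute)
  qed
  have U_slack: "(1 - e) * ((v t)\<^sup>2 - (u t)\<^sup>2) \<le> (v t)\<^sup>2 - (U t)\<^sup>2" if "t \<in> {0..T}" for t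
    using U2[OF that] by (simp add: algebra_simps)
  have tr: "trajectory T X y Z U v"
  proof
    show "0 \<le> T" "lipschitz_fun {0..T} X" "lipschitz_fun {0..T} y" "\<exists>B. \<forall>t\<in>{0..T}. v t \<le> B"
      "v \<in> borel_measurable (lebesgue_on {0..T})" "y 0 = 0"
      by (fact T_nonneg lip_X lip_y bounded_v meas_v start)+
    show "lipschitz_fun {0..T} Z" unfolding Z_def
      by (intro lipschitz_fun_intros lip_z lipschitz_fun_compose[OF lip_y lip_G yim])
    show "U \<in> borel_measurable (lebesgue_on {0..T})"
    proof -
      have m: "f \<in> borel_measurable (lebesgue_on {0..T})" if "lipschitz_fun {0..T} f" for f
        by (rule continuous_imp_measurable_on_sets_lebesgue[OF lipschitz_fun_continuous[OF that]]) auto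
      note [measurable] = m[OF lip_x] m[OF lip_X] meas_u meas_v measurable_compose[OF m[OF lip_y] h_meas]
      show ?thesis unfolding U_def by measurable
    qed
    show "\<bar>U t\<bar> \<le> v t" if "t \<in> {0..T}" for t
    proof (rule abs_le_square_iff[THEN iffD2, of "U t" "v t", unfolded abs_of_nonneg[OF v_nonneg[OF that]]])
      have "0 \<le> (1 - e) * ((v t)\<^sup>2 - (u t)\<^sup>2)" using causal_square[OF that] e by simp
      then show "(U t)\<^sup>2 \<le> (v t)\<^sup>2" using U_slack[OF that] by linarith
    qed
    show "X 0 = 0" "Z 0 = 0" using start g0 by (auto simp: X_def R_def Z_def G_def)
    obtain N where N: "negligible N"
      "\<And>t. t \<in> {0..T} - N \<Longrightarrow> (x has_real_derivative u t) (at t within {0..T})"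
      "\<And>t. t \<in> {0..T} - N \<Longrightarrow> (y has_real_derivative v t) (at t within {0..T})"
      "\<And>t. t \<in> {0..T} - N \<Longrightarrow> (z has_real_derivative (x t)\<^sup>2 / 2 * v t) (at t within {0..T})"
      using dynamics by blast
    obtain F where F: "\<And>c. finite (F c)" "\<And>c t. t \<in> {0..T} - F c \<Longrightarrow> y t = c \<Longrightarrow>
        \<exists>d>0. \<forall>s\<in>{0..T}. \<bar>s - t\<bar> < d \<longrightarrow> y s = c"
      using level_set_locally_constant by metis
    \<comment> \<open>Off \<open>M\<close> the derivative of \<open>g\<close> exists at \<open>y t\<close> or
      \<open>y\<close> is constant near \<open>t\<close>. The levels 0 and 1 belong to the list because
      \<open>g\<close>, and with it \<open>R\<close>, may vanish there.\<close>
    define M where "M = N \<union> (\<Union>c\<in>K \<union> {0, 1}. F c) \<union> {0, T}"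
    have "negligible M" unfolding M_def using N(1) F(1) K by (auto intro: negligible_finite)
    moreover have "(X has_real_derivative U t) (at t within {0..T}) \<and>
          (y has_real_derivative v t) (at t within {0..T}) \<and>
          (Z has_real_derivative (X t)\<^sup>2 / 2 * v t) (at t within {0..T})" if tM: "t \<in> {0..T} - M" for t
    proof (intro conjI)
      have tN: "t \<in> {0..T} - N" and t0T: "t \<in> {0..T}" "0 < t" "t < T"
        using tM by (auto simp: M_def)
      show dy: "(y has_real_derivative v t) (at t within {0..T})" by (rule N(3)[OF tN])
      have "((\<lambda>t. G (y t)) has_real_derivative g (y t) / 2 * v t) (at t within {0..T})"
        by (rule DERIV_image_chain[where f = G and g = y, unfolded o_def,
              OF DERIV_subset[OF G_der[OF y01[OF t0T(1)]] yim] dy])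
      then have "(Z has_real_derivative (1 - e) * ((x t)\<^sup>2 / 2 * v t) + e * (g (y t) / 2 * v t)) (at t within {0..T})"
        unfolding Z_def by (intro DERIV_add DERIV_cmult N(4)[OF tN])
      then show "(Z has_real_derivative (X t)\<^sup>2 / 2 * v t) (at t within {0..T})"
        by (simp add: X2[OF t0T(1)] R_def algebra_simps add_divide_distrib diff_divide_distrib)
      show "(X has_real_derivative U t) (at t within {0..T})"
      proof (cases "y t \<in> K \<union> {0, 1}")
        case True
        have "t \<in> {0..T} - F (y t)" using tM True by (auto simp: M_def)
        from F(2)[OF this refl] obtain d
          where d: "0 < d" "\<And>s. s \<in> {0..T} \<Longrightarrow> \<bar>s - t\<bar> < d \<Longrightarrow> y s = y t" by blast
        have xc: "x s = x t" if "s \<in> {0..T}" "\<bar>s - t\<bar> < d" for s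
        proof (cases "s \<le> t")
          case True
          from abs_x_increment_le[OF that(1) t0T(1) this] d(2)[OF that] show ?thesis by simp
        next
          case False
          then have "t \<le> s" by simp
          from abs_x_increment_le[OF t0T(1) that(1) this] d(2)[OF that] show ?thesis by simp
        qed
        have "(y has_real_derivative 0) (at t within {0..T})"
          by (rule has_field_derivative_transform_within[OF DERIV_const[of "y t"] d(1) t0T(1)])
             (use d in \<open>auto simp: dist_real_def\<close>)
        then have "v t = 0"
          using DERIV_unique dy t0T by (metis at_within_Icc_at)
        then have "U t = 0" using causal[OF t0T(1)] by (simp add: U_def)
        moreover have "(X has_real_derivative 0) (at t within {0..T})"
          by (rule has_field_derivative_transform_within[OF DERIV_const[of "X t"] d(1) t0T(1)])
             (use d xc in \<open>auto simp: dist_real_def X_def R_def\<close>)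
        ultimately show ?thesis by simp
      next
        case False
        then have yt: "0 < y t" "y t < 1" "y t \<notin> K" using y01[OF t0T(1)] by auto
        have Rpos: "0 < R t"
          using g_pos[OF yt(1,2)] e unfolding R_def by (intro add_nonneg_pos) auto
        have "(R has_real_derivative (1 - e) * (2 * x t * u t) + e * (2 * h (y t) * v t)) (at t within {0..T})"
          unfolding R_def
          by (intro DERIV_add DERIV_cmult DERIV_chain2[OF g_der dy])
             (use yt in \<open>auto intro!: derivative_eq_intros N(2)[OF tN]\<close>)
        from DERIV_chain2[OF DERIV_real_sqrt[OF Rpos] this]
        have D: "(X has_real_derivative inverse (sqrt (R t)) / 2 *
            ((1 - e) * (2 * x t * u t) + e * (2 * h (y t) * v t))) (at t within {0..T})"
          unfolding X_def[abs_def] .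
        have halve: "inverse q / 2 * (2 * p) = p / q" for p q :: real by (simp add: inverse_eq_divide)
        have "(1 - e) * (2 * x t * u t) + e * (2 * h (y t) * v t)
            = 2 * ((1 - e) * x t * u t + e * h (y t) * v t)" by (simp add: algebra_simps)
        from D[unfolded this halve] show ?thesis unfolding U_def X_def[of t] .
      qed
    qed
    ultimately show "\<exists>N. negligible N \<and> (\<forall>t\<in>{0..T} - N. (X has_real_derivative U t) (at t within {0..T}) \<and>
          (y has_real_derivative v t) (at t within {0..T}) \<and>
          (Z has_real_derivative (X t)\<^sup>2 / 2 * v t) (at t within {0..T}))" by blast
  qed
  have "(1 - e) * control_length T u v \<le> control_length T U v"
  proof (rule has_integral_le[OF has_integral_mult_right[OF has_integral_control_length]
        trajectory.has_integral_control_length[OF tr]])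
    fix t assume t: "t \<in> {0..T}"
    have sl: "0 \<le> (v t)\<^sup>2 - (u t)\<^sup>2" using causal_square[OF t] by simp
    have "(1 - e) * sqrt ((v t)\<^sup>2 - (u t)\<^sup>2) = sqrt ((1 - e)\<^sup>2 * ((v t)\<^sup>2 - (u t)\<^sup>2))"
      using e by (simp add: real_sqrt_mult)
    also have "\<dots> \<le> sqrt ((1 - e) * ((v t)\<^sup>2 - (u t)\<^sup>2))"
      using e sl by (intro real_sqrt_le_mono mult_right_mono) (auto simp: power2_eq_square intro: mult_left_le_one_le)
    also have "\<dots> \<le> sqrt ((v t)\<^sup>2 - (U t)\<^sup>2)" using U_slack[OF t] by (rule real_sqrt_le_mono)
    finally show "(1 - e) * sqrt ((v t)\<^sup>2 - (u t)\<^sup>2) \<le> sqrt ((v t)\<^sup>2 - (U t)\<^sup>2)" .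
  qed
  then show ?thesis
    using tr R0 yT by (intro exI[of _ X] exI[of _ Z] exI[of _ U]) (auto simp: X_def R_def Z_def G_def)
qed

section \<open>Endpoints and lengths on the plane y = 1\<close>

text \<open>
  The greatest height over \<open>x = r\<close>, \<open>y = 1\<close> for \<open>0 \<le> r \<le> 1\<close>.
\<close>

definition top_height :: "real \<Rightarrow> real" where
  "top_height r = ((1 + r) ^ 3 / 4 - r ^ 3) / 6"

text \<open>
  A convex combination of the squares of the lowest curve \<open>max 0 (s - (1 - r))\<close> and the highest curve
  \<open>min s (1 + r - s)\<close> from 0 to \<open>r\<close>. With a positive weight on the latter it is positive between the
  end points.
\<close>

definition mix_profile :: "real \<Rightarrow> real \<Rightarrow> real \<Rightarrow> real" where
  "mix_profile r \<theta> s = (1 - \<theta>) * (max 0 (s - (1 - r)))\<^sup>2 + \<theta> * (min s (1 + r - s))\<^sup>2"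

definition mix_slope :: "real \<Rightarrow> real \<Rightarrow> real \<Rightarrow> real" where
  "mix_slope r \<theta> s = (1 - \<theta>) * max 0 (s - (1 - r)) + \<theta> * (if s \<le> (1 + r) / 2 then s else s - (1 + r))"

lemma max_power_deriv:
  fixes s b :: real
  assumes "s \<noteq> b"
  shows "((\<lambda>s. max 0 (s - b) ^ Suc n) has_real_derivative real (Suc n) * max 0 (s - b) ^ n * (if s < b then 0 else 1)) (at s)"
proof (cases "s < b")
  case True
  show ?thesis
    by (rule has_field_derivative_transform_within_open[of "\<lambda>_. 0" _ _ "{..<b}"])
       (use True in \<open>auto simp: max_def\<close>)
next
  case False
  show ?thesis
    by (rule has_field_derivative_transform_within_open[of "\<lambda>s. (s - b) ^ Suc n" _ _ "{b<..}"])
       (use False assms in \<open>auto simp: max_def simp del: power_Suc intro!: derivative_eq_intros\<close>)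
qed

lemma mix_profile_deriv:
  assumes "s \<noteq> 1 - r" "s \<noteq> (1 + r) / 2"
  shows "(mix_profile r \<theta> has_real_derivative 2 * mix_slope r \<theta> s) (at s)"
proof -
  have 1: "((\<lambda>s. (max 0 (s - (1 - r)))\<^sup>2) has_real_derivative 2 * max 0 (s - (1 - r))) (at s)"
    using max_power_deriv[OF assms(1), of 1]
    by (cases "s < 1 - r") (auto simp: numeral_2_eq_2)
  have 2: "((\<lambda>s. (min s (1 + r - s))\<^sup>2) has_real_derivative
      2 * (if s \<le> (1 + r) / 2 then s else s - (1 + r))) (at s)"
  proof (cases "s < (1 + r) / 2")
    case True
    show ?thesis
      by (rule has_field_derivative_transform_within_open[of "\<lambda>s. s\<^sup>2" _ _ "{..<(1 + r) / 2}"])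
         (use True in \<open>auto simp: min_def intro!: derivative_eq_intros\<close>)
  next
    case False
    show ?thesis
      by (rule has_field_derivative_transform_within_open[of "\<lambda>s. (1 + r - s)\<^sup>2" _ _ "{(1 + r) / 2<..}"])
         (use False assms(2) in \<open>auto simp: min_def intro!: derivative_eq_intros\<close>)
  qed
  show ?thesis
    using DERIV_add[OF DERIV_cmult[OF 1, of "1 - \<theta>"] DERIV_cmult[OF 2, of \<theta>]]
    unfolding mix_profile_def[abs_def] mix_slope_def by (simp add: algebra_simps)
qed

text \<open>
  Both curves have slope at most 1, and squaring is convex.
\<close>

lemma mix_slope_le_profile:
  assumes "0 \<le> \<theta>" "\<theta> \<le> 1"
  shows "(mix_slope r \<theta> s)\<^sup>2 \<le> mix_profile r \<theta> s"
proof -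
  have convex: "((1 - \<theta>) * a + \<theta> * b)\<^sup>2 \<le> (1 - \<theta>) * a\<^sup>2 + \<theta> * b\<^sup>2" for a b :: real
  proof -
    have "(1 - \<theta>) * a\<^sup>2 + \<theta> * b\<^sup>2 - ((1 - \<theta>) * a + \<theta> * b)\<^sup>2 = (1 - \<theta>) * \<theta> * (a - b)\<^sup>2"
      by (simp add: power2_eq_square algebra_simps)
    also have "\<dots> \<ge> 0" using assms by simp
    finally show ?thesis by simp
  qed
  have "(if s \<le> (1 + r) / 2 then s else s - (1 + r))\<^sup>2 = (min s (1 + r - s))\<^sup>2"
    by (auto simp: min_def power2_commute[of s "1 + r"])
  then show ?thesis
    unfolding mix_slope_def mix_profile_def using convex by metis
qed

lemma mix_profile_integral:
  assumes "0 \<le> r" "r \<le> 1"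
  shows "integral {0..1} (\<lambda>s. mix_profile r \<theta> s / 2) = (1 - \<theta>) * (r ^ 3 / 6) + \<theta> * top_height r"
proof -
  define a where "a = (1 + r) / 2"
  have 1: "((\<lambda>s. (max 0 (s - (1 - r)))\<^sup>2 / 2) has_integral
      max 0 (1 - (1 - r)) ^ 3 / 6 - max 0 (0 - (1 - r)) ^ 3 / 6) {0..1}"
  proof (rule fundamental_theorem_of_calculus_interior_strong[where S = "{1 - r}"])
    fix s assume "s \<in> {0<..<1} - {1 - r}"
    then have "((\<lambda>s. max 0 (s - (1 - r)) ^ 3 / 6) has_real_derivative (max 0 (s - (1 - r)))\<^sup>2 / 2) (at s)"
      using DERIV_cdivide[OF max_power_deriv[of s "1 - r" 2], of 6]
      by (cases "s < 1 - r") (auto simp: numeral_3_eq_3 numeral_2_eq_2)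
    then show "((\<lambda>s. max 0 (s - (1 - r)) ^ 3 / 6) has_vector_derivative (max 0 (s - (1 - r)))\<^sup>2 / 2) (at s)"
      by (simp add: has_real_derivative_iff_has_vector_derivative)
  qed (auto intro!: continuous_intros)
  \<comment> \<open>The antiderivative is written with \<open>min\<close> and \<open>max\<close> so that its continuity
    at the turning point \<open>a\<close> is evident; there \<open>1 + r - a = a\<close>.\<close>
  have 2: "((\<lambda>s. (min s (1 + r - s))\<^sup>2 / 2) has_integral
      (min 1 a ^ 3 + a ^ 3 - (1 + r - max 1 a) ^ 3) / 6 - (min 0 a ^ 3 + a ^ 3 - (1 + r - max 0 a) ^ 3) / 6) {0..1}"
  proof (rule fundamental_theorem_of_calculus_interior_strong[where S = "{a}"])
    fix s assume s: "s \<in> {0<..<1} - {a}"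
    have "((\<lambda>s. (min s a ^ 3 + a ^ 3 - (1 + r - max s a) ^ 3) / 6) has_real_derivative (min s (1 + r - s))\<^sup>2 / 2) (at s)"
    proof (cases "s < a")
      case True
      show ?thesis
        by (rule has_field_derivative_transform_within_open[of
              "\<lambda>s. (s ^ 3 + a ^ 3 - (1 + r - a) ^ 3) / 6" _ _ "{..<a}"])
           (use True in \<open>auto simp: min_def max_def a_def intro!: derivative_eq_intros\<close>)
    next
      case False
      then have "a < s" using s by auto
      show ?thesis
        by (rule has_field_derivative_transform_within_open[of
              "\<lambda>s. (a ^ 3 + a ^ 3 - (1 + r - s) ^ 3) / 6" _ _ "{a<..}"])
           (use \<open>a < s\<close> in \<open>auto simp: min_def max_def a_def intro!: derivative_eq_intros\<close>)
    qed
    then show "((\<lambda>s. (min s a ^ 3 + a ^ 3 - (1 + r - max s a) ^ 3) / 6) has_vector_derivative (min s (1 + r - s))\<^sup>2 / 2) (at s)"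
      by (simp add: has_real_derivative_iff_has_vector_derivative)
  qed (auto intro!: continuous_intros)
  have I: "((\<lambda>s. mix_profile r \<theta> s / 2) has_integral
      (1 - \<theta>) * (max 0 (1 - (1 - r)) ^ 3 / 6 - max 0 (0 - (1 - r)) ^ 3 / 6) + \<theta> *
      ((min 1 a ^ 3 + a ^ 3 - (1 + r - max 1 a) ^ 3) / 6 - (min 0 a ^ 3 + a ^ 3 - (1 + r - max 0 a) ^ 3) / 6)) {0..1}"
    using has_integral_add[OF has_integral_mult_right[OF 1, of "1 - \<theta>"] has_integral_mult_right[OF 2, of \<theta>]]
    by (simp add: mix_profile_def add_divide_distrib)
  have eqs: "max 0 (1 - (1 - r)) = r" "max 0 (0 - (1 - r)) = 0" "min 1 a = a" "max 1 a = 1" "min 0 a = 0" "max 0 a = a"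
    "1 + r - a = a"
    using assms by (auto simp: a_def max_def min_def field_simps)
  have top: "(a ^ 3 + a ^ 3 - (1 + r - 1) ^ 3) / 6 - (0 ^ 3 + a ^ 3 - a ^ 3) / 6 = top_height r"
    by (simp add: top_height_def a_def power_divide)
  from integral_unique[OF I[unfolded eqs top]] show ?thesis by simp
qed

lemma (in trajectory) mix_with_profile:
  assumes "y T = 1" "0 \<le> r" "r \<le> 1" "0 < \<theta>" "\<theta> \<le> 1" "0 < e" "e \<le> 1"
  shows "\<exists>X Z U. trajectory T X y Z U v \<and> (\<forall>t\<in>{0..T}. 0 \<le> X t) \<and>
    X T = sqrt ((1 - e) * (x T)\<^sup>2 + e * r\<^sup>2) \<and>
    Z T = (1 - e) * z T + e * ((1 - \<theta>) * (r ^ 3 / 6) + \<theta> * top_height r) \<and>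
    (1 - e) * control_length T u v \<le> control_length T U v"
proof -
  have end1: "mix_profile r \<theta> 1 = r\<^sup>2"
    using assms by (simp add: mix_profile_def max_def min_def algebra_simps)
  have "\<exists>X Z U. trajectory T X y Z U v \<and> (\<forall>t\<in>{0..T}. 0 \<le> X t) \<and>
    X T = sqrt ((1 - e) * (x T)\<^sup>2 + e * mix_profile r \<theta> 1) \<and>
    Z T = (1 - e) * z T + e * integral {0..1} (\<lambda>s. mix_profile r \<theta> s / 2) \<and>
    (1 - e) * control_length T u v \<le> control_length T U v"
  proof (rule mix_with_curve[where K = "{1 - r, (1 + r) / 2}" and h = "mix_slope r \<theta>"])
    show "mix_profile r \<theta> 0 = 0" using assms by (simp add: mix_profile_def)
    show "0 \<le> mix_profile r \<theta> s" for s using assms by (simp add: mix_profile_def)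
    show "lipschitz_fun {0..1} (\<lambda>s. sqrt (mix_profile r \<theta> s))"
    proof -
      have "lipschitz_fun {0..1} (\<lambda>s. sqrt ((sqrt (1 - \<theta>) * max 0 (s - (1 - r)))\<^sup>2
          + (sqrt \<theta> * (s - max 0 (s - (1 + r - s))))\<^sup>2))"
        by (intro lipschitz_fun_sqrt_sum_squares lipschitz_fun_intros)
      moreover have "min s (1 + r - s) = s - max 0 (s - (1 + r - s))" for s
        by (auto simp: min_def max_def)
      ultimately show ?thesis
        using assms by (simp add: mix_profile_def power_mult_distrib)
    qed
    show "mix_slope r \<theta> \<in> borel_measurable borel"
      unfolding mix_slope_def[abs_def] by measurable
    show "(mix_slope r \<theta> s)\<^sup>2 \<le> mix_profile r \<theta> s" for s
      using mix_slope_le_profile assms by simp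
    show "0 < mix_profile r \<theta> s" if "0 < s" "s < 1" for s
    proof -
      have "0 < \<theta> * (min s (1 + r - s))\<^sup>2" using that assms by (simp add: zero_less_mult_iff)
      then show ?thesis using assms unfolding mix_profile_def by (intro add_nonneg_pos) auto
    qed
    show "(mix_profile r \<theta> has_real_derivative 2 * mix_slope r \<theta> s) (at s)"
      if "s \<in> {0<..<1} - {1 - r, (1 + r) / 2}" for s
      by (rule mix_profile_deriv) (use that in auto)
  qed (use assms in auto)
  then show ?thesis unfolding end1 mix_profile_integral[OF assms(2,3)] .
qed

text \<open>
  The heights of the curves from 0 to \<open>r\<close> fill the whole interval between the least and the greatest one, so
  an end point can be moved towards any prescribed \<open>(r\<^sup>2, h)\<close> above the lower boundary.
\<close>

lemma lengths_to_mix: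
  assumes l: "l \<in> lengths_to (a, 1, c)" and r: "0 \<le> r" "r \<le> 1"
    and h: "r ^ 3 / 6 < h" "h \<le> top_height r" and e: "0 < e" "e \<le> 1"
  shows "\<exists>l'. l' \<in> lengths_to (sqrt ((1 - e) * a\<^sup>2 + e * r\<^sup>2), 1, (1 - e) * c + e * h) \<and> (1 - e) * l \<le> l'"
proof -
  obtain T x y z u v where *: "trajectory T x y z u v" "x T = a" "y T = 1" "z T = c" "l = control_length T u v"
    using l unfolding lengths_to_iff by blast
  define \<theta> where "\<theta> = (h - r ^ 3 / 6) / (top_height r - r ^ 3 / 6)"
  have \<theta>: "0 < \<theta>" "\<theta> \<le> 1" using h by (auto simp: \<theta>_def)
  have "\<theta> * (top_height r - r ^ 3 / 6) = h - r ^ 3 / 6" using h by (simp add: \<theta>_def)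
  then have "(1 - \<theta>) * (r ^ 3 / 6) + \<theta> * top_height r = h"
    unfolding right_diff_distrib left_diff_distrib by linarith
  with trajectory.mix_with_profile[OF *(1,3) r \<theta> e] obtain X Z U where
    "trajectory T X y Z U v" "X T = sqrt ((1 - e) * (x T)\<^sup>2 + e * r\<^sup>2)" "Z T = (1 - e) * z T + e * h"
    "(1 - e) * control_length T u v \<le> control_length T U v" by auto
  then show ?thesis unfolding lengths_to_iff using * by blast
qed

text \<open>
  For trajectories with \<open>x \<ge> 0\<close> the two statements about \<open>top_height\<close> say that the gap is nonnegative, and
  zero only if the length is zero. Mixing in equal parts with the highest curve makes \<open>x\<close> nonnegative; it halves the distance from the
  greatest height and at most halves the length, which is enough for both.
\<close>

lemma lengths_to_bounds:
  assumes "l \<in> lengths_to (a, 1, c)"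
  shows "0 \<le> l" "l \<le> 1" "\<bar>a\<bar> \<le> 1" "\<bar>a\<bar> ^ 3 / 6 \<le> c" "c \<le> top_height \<bar>a\<bar>" "0 < l \<Longrightarrow> c < top_height \<bar>a\<bar>"
    "0 < s \<Longrightarrow> l \<le> 1 - \<bar>a\<bar> + 2 * s\<^sup>2 * (c - \<bar>a\<bar> ^ 3 / 6) + 2 / s"
proof -
  obtain T x y z u v where *: "trajectory T x y z u v" "x T = a" "y T = 1" "z T = c" "l = control_length T u v"
    using assms unfolding lengths_to_iff by blast
  interpret trajectory T x y z u v by fact
  show "0 \<le> l" "l \<le> 1" "\<bar>a\<bar> ^ 3 / 6 \<le> c"
    using control_length_nonneg control_length_le_y abs_x_cube_le_z * by auto
  show a1: "\<bar>a\<bar> \<le> 1" using abs_x_le_y[of T] T_nonneg * by simp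
  obtain X Z U where m: "trajectory T X y Z U v" "\<forall>t\<in>{0..T}. 0 \<le> X t"
    "X T = sqrt ((1 - 1/2) * (x T)\<^sup>2 + 1/2 * \<bar>a\<bar>\<^sup>2)"
    "Z T = (1 - 1/2) * z T + 1/2 * ((1 - 1) * (\<bar>a\<bar> ^ 3 / 6) + 1 * top_height \<bar>a\<bar>)"
    "(1 - 1/2) * control_length T u v \<le> control_length T U v"
    using mix_with_profile[OF *(3), of "\<bar>a\<bar>" 1 "1/2"] a1 by auto
  interpret m: trajectory T X y Z U v by fact
  have "X T = \<bar>a\<bar>" using m(3) * by simp
  then have gap: "m.top_gap T = (top_height \<bar>a\<bar> - c) / 2"
    using m(4) * by (simp add: m.top_gap_def top_height_def field_simps)
  then show c: "c \<le> top_height \<bar>a\<bar>" using m.top_gap_nonneg m(2) by simp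
  show "c < top_height \<bar>a\<bar>" if "0 < l"
  proof (rule ccontr)
    assume "\<not> c < top_height \<bar>a\<bar>"
    then have "m.top_gap T = 0" using gap c by simp
    then have "control_length T U v = 0" using m.control_length_eq_0_at_top m(2) by blast
    then show False using m(5) * that by simp
  qed
  show "l \<le> 1 - \<bar>a\<bar> + 2 * s\<^sup>2 * (c - \<bar>a\<bar> ^ 3 / 6) + 2 / s" if s: "0 < s"
  proof -
    have "l \<in> lengths_to (\<bar>a\<bar>, 1, c)"
      using assms lengths_to_reflect[OF assms] by (auto simp: abs_if)
    then obtain T x y z u v where *: "trajectory T x y z u v" "x T = \<bar>a\<bar>" "y T = 1" "z T = c" "l = control_length T u v"
      unfolding lengths_to_iff by blast
    from trajectory.control_length_le_near_bottom[OF *(1) s] show ?thesis using * by simp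
  qed
qed

section \<open>Continuity of the distance on the plane y = 1\<close>

lemma bottom_less_top:
  assumes "0 \<le> r" "r < 1"
  shows "r ^ 3 / 6 < top_height r"
proof -
  have "top_height r - r ^ 3 / 6 = (1 - r) * (1 + 4 * r + 7 * r\<^sup>2) / 24"
    by (simp add: top_height_def power2_eq_square power3_eq_cube field_simps)
  also have "\<dots> > 0" using assms by (intro divide_pos_pos mult_pos_pos add_pos_nonneg) auto
  finally show ?thesis by simp
qed

definition slice_dist :: "real \<Rightarrow> real \<Rightarrow> real" where
  "slice_dist a c = Sup (lengths_to (a, 1, c))"

definition slice :: "(real \<times> real) set" where
  "slice = {(a, c). \<bar>a\<bar> < 1 \<and> \<bar>a\<bar> ^ 3 / 6 \<le> c \<and> c < top_height \<bar>a\<bar>}"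

lemma lengths_to_abs: "lengths_to (\<bar>a\<bar>, b, c) = lengths_to (a, b, c)"
  using lengths_to_reflect[of _ a b c] lengths_to_reflect[of _ "- a" b c] by (auto simp: abs_if)

lemma slice_dist_abs: "slice_dist \<bar>a\<bar> c = slice_dist a c"
  by (simp add: slice_dist_def lengths_to_abs)

lemma slice_abs: "(\<bar>a\<bar>, c) \<in> slice \<longleftrightarrow> (a, c) \<in> slice"
  by (simp add: slice_def)

lemma bdd_above_lengths_to: "bdd_above (lengths_to (a, 1, c))"
  by (rule bdd_aboveI[of _ 1]) (rule lengths_to_bounds)

lemma le_slice_dist: "l \<in> lengths_to (a, 1, c) \<Longrightarrow> l \<le> slice_dist a c"
  unfolding slice_dist_def by (rule cSup_upper[OF _ bdd_above_lengths_to])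

lemma slice_dist_leI:
  "lengths_to (a, 1, c) \<noteq> {} \<Longrightarrow> (\<And>l. l \<in> lengths_to (a, 1, c) \<Longrightarrow> l \<le> m) \<Longrightarrow> slice_dist a c \<le> m"
  unfolding slice_dist_def by (rule cSup_least)

text \<open>
  The point lies on the vertical segment between the lowest and the highest point with the same \<open>x\<close>, so the
  length \<open>1 - \<bar>a\<bar>\<close> of the lowest trajectory survives in proportion.
\<close>

lemma length_to_slice:
  assumes "(a, c) \<in> slice"
  shows "\<exists>l\<in>lengths_to (a, 1, c).
    (1 - (c - \<bar>a\<bar> ^ 3 / 6) / (top_height \<bar>a\<bar> - \<bar>a\<bar> ^ 3 / 6)) * (1 - \<bar>a\<bar>) \<le> l"
proof -
  define r where "r = \<bar>a\<bar>"
  define e where "e = (c - r ^ 3 / 6) / (top_height r - r ^ 3 / 6)"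
  have r: "0 \<le> r" "r < 1" "r ^ 3 / 6 \<le> c" "c < top_height r" using assms by (auto simp: slice_def r_def)
  have gap: "r ^ 3 / 6 < top_height r" by (rule bottom_less_top[OF r(1,2)])
  have "\<exists>l\<in>lengths_to (r, 1, c). (1 - e) * (1 - r) \<le> l"
  proof (cases "c = r ^ 3 / 6")
    case True
    have "1 - r \<in> lengths_to (r, 1, c)" unfolding True by (rule lengths_to_bottom) (use r in auto)
    moreover have "e = 0" by (simp add: e_def True)
    ultimately show ?thesis by auto
  next
    case False
    then have e: "0 < e" "e \<le> 1" using r gap by (auto simp: e_def)
    have "e * (top_height r - r ^ 3 / 6) = c - r ^ 3 / 6" using gap by (simp add: e_def)
    then have "(1 - e) * (r ^ 3 / 6) + e * top_height r = c"
      unfolding right_diff_distrib left_diff_distrib by linarith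
    moreover have "sqrt ((1 - e) * r\<^sup>2 + e * r\<^sup>2) = r" using r by (simp add: algebra_simps)
    ultimately show ?thesis
      using lengths_to_mix[OF lengths_to_bottom[of r] _ _ gap order_refl e] r by auto
  qed
  then show ?thesis by (simp add: r_def e_def lengths_to_abs)
qed

lemma lengths_to_slice_nonempty: "(a, c) \<in> slice \<Longrightarrow> lengths_to (a, 1, c) \<noteq> {}"
  using length_to_slice by blast

lemma slice_dist_lower:
  assumes "(a, c) \<in> slice"
  shows "(1 - (c - \<bar>a\<bar> ^ 3 / 6) / (top_height \<bar>a\<bar> - \<bar>a\<bar> ^ 3 / 6)) * (1 - \<bar>a\<bar>) \<le> slice_dist a c"
  using length_to_slice[OF assms] le_slice_dist order_trans by blast

lemma slice_dist_upper:
  assumes "(a, c) \<in> slice" "0 < s"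
  shows "slice_dist a c \<le> 1 - \<bar>a\<bar> + 2 * s\<^sup>2 * (c - \<bar>a\<bar> ^ 3 / 6) + 2 / s"
  by (rule slice_dist_leI[OF lengths_to_slice_nonempty[OF assms(1)]]) (rule lengths_to_bounds(7)[OF _ assms(2)])

lemma slice_dist_le_1: "(a, c) \<in> slice \<Longrightarrow> slice_dist a c \<le> 1"
  by (rule slice_dist_leI[OF lengths_to_slice_nonempty]) (auto intro: lengths_to_bounds)

lemma slice_dist_pos:
  assumes "(a, c) \<in> slice"
  shows "0 < slice_dist a c"
proof -
  have "c - \<bar>a\<bar> ^ 3 / 6 < top_height \<bar>a\<bar> - \<bar>a\<bar> ^ 3 / 6" "\<bar>a\<bar> ^ 3 / 6 < top_height \<bar>a\<bar>" "\<bar>a\<bar> < 1"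
    using assms by (auto simp: slice_def)
  then have "0 < (1 - (c - \<bar>a\<bar> ^ 3 / 6) / (top_height \<bar>a\<bar> - \<bar>a\<bar> ^ 3 / 6)) * (1 - \<bar>a\<bar>)"
    by (intro mult_pos_pos) auto
  then show ?thesis using slice_dist_lower[OF assms] by linarith
qed

text \<open>
  At \<open>\<bar>a\<bar> = 1\<close> the least and the greatest height coincide, so no trajectory of positive length ends there.
\<close>

lemma slice_of_positive_length:
  assumes "l \<in> lengths_to (a, 1, c)" "0 < l"
  shows "(a, c) \<in> slice"
proof -
  note b = lengths_to_bounds[OF assms(1)]
  have c: "c < top_height \<bar>a\<bar>" by (rule b(6)[OF assms(2)])
  moreover have "\<bar>a\<bar> \<noteq> 1"
  proof
    assume "\<bar>a\<bar> = 1"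
    then show False using b(4) c by (simp add: top_height_def)
  qed
  ultimately show ?thesis using b(3,4) by (auto simp: slice_def)
qed

text \<open>
  In the coordinates \<open>(x\<^sup>2, z)\<close>, the point \<open>(r, h)\<close> with \<open>h = c + (d - c) / e\<close> is where the segment from
  \<open>(a, c)\<close> to \<open>(b, d)\<close> ends after being stretched by the factor \<open>1 / e\<close>. If it is still admissible, the
  passage from \<open>(a, c)\<close> to \<open>(b, d)\<close> loses at most the factor \<open>1 - e\<close>.
\<close>

lemma slice_dist_mix:
  assumes P: "(a, c) \<in> slice" and e: "0 < e" "e \<le> 1"
    and r: "0 \<le> a\<^sup>2 + (b\<^sup>2 - a\<^sup>2) / e" "r = sqrt (a\<^sup>2 + (b\<^sup>2 - a\<^sup>2) / e)" "r < 1"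
    and h: "r ^ 3 / 6 < c + (d - c) / e" "c + (d - c) / e < top_height r"
  shows "(1 - e) * slice_dist a c \<le> slice_dist b d"
proof (cases "e = 1")
  case True
  have "\<bar>b\<bar> = r" using r True by simp
  then have "(b, d) \<in> slice" using h r True by (auto simp: slice_def)
  then show ?thesis using slice_dist_pos True by fastforce
next
  case False
  then have e1: "0 < 1 - e" using e by simp
  have r0: "0 \<le> r" using r by simp
  have "r\<^sup>2 = a\<^sup>2 + (b\<^sup>2 - a\<^sup>2) / e" using r by simp
  then have "(1 - e) * a\<^sup>2 + e * r\<^sup>2 = b\<^sup>2" using e by (simp add: field_simps)
  then have eqb: "sqrt ((1 - e) * a\<^sup>2 + e * r\<^sup>2) = \<bar>b\<bar>" by simp
  have eqd: "(1 - e) * c + e * (c + (d - c) / e) = d" using e by (simp add: field_simps)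
  have "l \<le> slice_dist b d / (1 - e)" if l: "l \<in> lengths_to (a, 1, c)" for l
  proof -
    obtain l' where l': "l' \<in> lengths_to (\<bar>b\<bar>, 1, d)" "(1 - e) * l \<le> l'"
      using lengths_to_mix[OF l r0 _ h(1) _ e] h(2) r(3) unfolding eqb eqd by auto
    have "(1 - e) * l \<le> slice_dist b d"
      using le_slice_dist[OF l'(1)] l'(2) by (simp add: slice_dist_abs)
    then show ?thesis using e1 by (simp add: field_simps)
  qed
  then have "slice_dist a c \<le> slice_dist b d / (1 - e)"
    by (rule slice_dist_leI[OF lengths_to_slice_nonempty[OF P]])
  then show ?thesis using e1 by (simp add: field_simps)
qed

text \<open>
  A way to reach \<open>x = 0\<close> exactly. Mixing cannot do this, since a combination of \<open>a\<^sup>2 > 0\<close> with a nonnegative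
  number stays positive.
\<close>

lemma slice_dist_append:
  assumes "(a, c) \<in> slice" "0 \<le> a"
  shows "slice_dist a c \<le> (1 + a) * slice_dist 0 ((c + a ^ 3 / 6) / (1 + a) ^ 3)"
proof (rule slice_dist_leI[OF lengths_to_slice_nonempty[OF assms(1)]])
  fix l assume "l \<in> lengths_to (a, 1, c)"
  then have "l \<in> lengths_to (0, 1 + a, c + a ^ 3 / 6)" by (rule lengths_to_append[OF _ assms(2)])
  from lengths_to_dilate[OF this, of "1 / (1 + a)"]
  have "l / (1 + a) \<in> lengths_to (0, 1, (c + a ^ 3 / 6) / (1 + a) ^ 3)"
    using assms(2) by (simp add: power_divide)
  from le_slice_dist[OF this] show "l \<le> (1 + a) * slice_dist 0 ((c + a ^ 3 / 6) / (1 + a) ^ 3)"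
    using assms(2) by (simp add: field_simps)
qed

lemma tendsto_top_height [tendsto_intros]:
  "(f \<longlongrightarrow> r) F \<Longrightarrow> ((\<lambda>n. top_height (f n)) \<longlongrightarrow> top_height r) F"
  unfolding top_height_def by (intro tendsto_intros) auto

text \<open>
  For neighbouring points the stretched end point stays near \<open>(r0, c0)\<close> for each fixed \<open>e\<close>, hence is
  admissible provided that its squared first coordinate is nonnegative.
\<close>

lemma eventually_slice_dist_mix:
  assumes lims: "(a \<longlongrightarrow> r0) F" "(b \<longlongrightarrow> r0) F" "(c \<longlongrightarrow> c0) F" "(d \<longlongrightarrow> c0) F"
    and P: "\<forall>\<^sub>F n in F. (a n, c n) \<in> slice"
    and r0: "0 \<le> r0" "r0 < 1" and c0: "r0 ^ 3 / 6 < c0" "c0 < top_height r0"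
    and e: "0 < e" "e \<le> 1"
    and nonneg: "\<forall>\<^sub>F n in F. 0 \<le> (a n)\<^sup>2 + ((b n)\<^sup>2 - (a n)\<^sup>2) / e"
  shows "\<forall>\<^sub>F n in F. (1 - e) * slice_dist (a n) (c n) \<le> slice_dist (b n) (d n)"
proof -
  define r where "r n = sqrt ((a n)\<^sup>2 + ((b n)\<^sup>2 - (a n)\<^sup>2) / e)" for n
  define h where "h n = c n + (d n - c n) / e" for n
  have "(r \<longlongrightarrow> sqrt (r0\<^sup>2 + (r0\<^sup>2 - r0\<^sup>2) / e)) F"
    unfolding r_def by (intro tendsto_intros lims) (use e in auto)
  then have r: "(r \<longlongrightarrow> r0) F" using r0 by simp
  have "(h \<longlongrightarrow> c0 + (c0 - c0) / e) F"
    unfolding h_def by (intro tendsto_intros lims) (use e in auto)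
  then have h: "(h \<longlongrightarrow> c0) F" by simp
  have "((\<lambda>n. h n - r n ^ 3 / 6) \<longlongrightarrow> c0 - r0 ^ 3 / 6) F" by (intro tendsto_intros r h) auto
  from order_tendstoD(1)[OF this, of 0] have 1: "\<forall>\<^sub>F n in F. 0 < h n - r n ^ 3 / 6" using c0 by simp
  have "((\<lambda>n. top_height (r n) - h n) \<longlongrightarrow> top_height r0 - c0) F" by (intro tendsto_intros r h)
  from order_tendstoD(1)[OF this, of 0] have 2: "\<forall>\<^sub>F n in F. 0 < top_height (r n) - h n" using c0 by simp
  have 3: "\<forall>\<^sub>F n in F. r n < 1" by (rule order_tendstoD(2)[OF r r0(2)])
  show ?thesis using P nonneg 1 2 3
  proof eventually_elim
    case (elim n)
    show ?case
      by (rule slice_dist_mix[OF elim(1) e elim(2) r_def]) (use elim in \<open>auto simp: h_def\<close>)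
  qed
qed

text \<open>
  On the lower boundary curve the value is \<open>1 - r0\<close>, and the explicit lower and upper bounds both tend to it.
  Above the curve, mixing bounds the limit value by the nearby ones and conversely, each up to a factor close
  to 1. Only the upper bound at \<open>r0 = 0\<close> needs the detour through the line \<open>x = 0\<close> by an appended segment,
  followed by a vertical move.
\<close>

lemma tendsto_slice_dist:
  fixes a c :: "'n \<Rightarrow> real"
  assumes a: "(a \<longlongrightarrow> r0) F" and c: "(c \<longlongrightarrow> c0) F"
    and P: "\<forall>\<^sub>F n in F. (a n, c n) \<in> slice \<and> 0 \<le> a n"
    and P0: "(r0, c0) \<in> slice" "0 \<le> r0"
  shows "((\<lambda>n. slice_dist (a n) (c n)) \<longlongrightarrow> slice_dist r0 c0) F"
proof (cases "c0 = r0 ^ 3 / 6")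
  case bottom: True
  then have gap0: "c0 - r0 ^ 3 / 6 = 0" by simp
  have gap: "top_height r0 - r0 ^ 3 / 6 \<noteq> 0" using P0 bottom by (auto simp: slice_def)
  have f0: "slice_dist r0 c0 = 1 - r0"
  proof (rule antisym)
    show "slice_dist r0 c0 \<le> 1 - r0"
    proof (rule field_le_epsilon)
      fix \<eta> :: real assume "0 < \<eta>"
      then show "slice_dist r0 c0 \<le> 1 - r0 + \<eta>"
        using slice_dist_upper[OF P0(1), of "2 / \<eta>"] P0(2) by (simp add: gap0)
    qed
    show "1 - r0 \<le> slice_dist r0 c0" using slice_dist_lower[OF P0(1)] P0(2) by (simp add: gap0)
  qed
  show ?thesis unfolding f0
  proof (rule order_tendstoI)
    fix m assume m: "m < 1 - r0"
    have "((\<lambda>n. (1 - (c n - a n ^ 3 / 6) / (top_height (a n) - a n ^ 3 / 6)) * (1 - a n)) \<longlongrightarrow>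
        (1 - (c0 - r0 ^ 3 / 6) / (top_height r0 - r0 ^ 3 / 6)) * (1 - r0)) F"
      by (intro tendsto_intros a c gap) auto
    from order_tendstoD(1)[OF this, of m] have
      "\<forall>\<^sub>F n in F. m < (1 - (c n - a n ^ 3 / 6) / (top_height (a n) - a n ^ 3 / 6)) * (1 - a n)"
      using m by (simp add: gap0)
    then show "\<forall>\<^sub>F n in F. m < slice_dist (a n) (c n)" using P
      by eventually_elim (use slice_dist_lower in force)
  next
    fix m assume m: "1 - r0 < m"
    define s where "s = 4 / (m - (1 - r0))"
    have s: "0 < s" "2 / s = (m - (1 - r0)) / 2" using m by (auto simp: s_def)
    have "((\<lambda>n. 1 - a n + 2 * s\<^sup>2 * (c n - a n ^ 3 / 6) + 2 / s) \<longlongrightarrow>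
        1 - r0 + 2 * s\<^sup>2 * (c0 - r0 ^ 3 / 6) + 2 / s) F"
      by (intro tendsto_intros a c) auto
    moreover have "1 - r0 + 2 * s\<^sup>2 * (c0 - r0 ^ 3 / 6) + 2 / s < m"
      unfolding gap0 s(2) using m by (simp add: field_simps)
    ultimately have "\<forall>\<^sub>F n in F. 1 - a n + 2 * s\<^sup>2 * (c n - a n ^ 3 / 6) + 2 / s < m"
      by (rule order_tendstoD(2))
    then show "\<forall>\<^sub>F n in F. slice_dist (a n) (c n) < m" using P
    proof eventually_elim
      case (elim n)
      then show ?case using slice_dist_upper[of "a n" "c n" s] s(1) by simp
    qed
  qed
next
  case False
  have r0: "0 \<le> r0" "r0 < 1" and c0: "r0 ^ 3 / 6 < c0" "c0 < top_height r0"
    using P0 False by (auto simp: slice_def)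
  have lower: "\<forall>\<^sub>F n in F. (1 - e) * slice_dist r0 c0 \<le> slice_dist (a n) (c n)" if e: "0 < e" "e \<le> 1" for e
  proof (rule eventually_slice_dist_mix[OF tendsto_const a tendsto_const c _ r0 c0 e])
    show "\<forall>\<^sub>F n in F. 0 \<le> r0\<^sup>2 + ((a n)\<^sup>2 - r0\<^sup>2) / e"
    proof (cases "r0 = 0")
      case True then show ?thesis using e by simp
    next
      case False
      have "((\<lambda>n. r0\<^sup>2 + ((a n)\<^sup>2 - r0\<^sup>2) / e) \<longlongrightarrow> r0\<^sup>2 + (r0\<^sup>2 - r0\<^sup>2) / e) F"
        by (intro tendsto_intros a) (use e in auto)
      from order_tendstoD(1)[OF this, of 0] show ?thesis using False
        by (auto elim: eventually_mono)
    qed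
  qed (use P0 in auto)
  have upper: "\<forall>\<^sub>F n in F. (1 - e) * ((1 - e) * slice_dist (a n) (c n)) \<le> slice_dist r0 c0"
    if e: "0 < e" "e \<le> 1" for e
  proof (cases "r0 = 0")
    case False
    have "((\<lambda>n. (a n)\<^sup>2 + (r0\<^sup>2 - (a n)\<^sup>2) / e) \<longlongrightarrow> r0\<^sup>2 + (r0\<^sup>2 - r0\<^sup>2) / e) F"
      by (intro tendsto_intros a) (use e in auto)
    from order_tendstoD(1)[OF this, of 0] have
      nn: "\<forall>\<^sub>F n in F. 0 \<le> (a n)\<^sup>2 + (r0\<^sup>2 - (a n)\<^sup>2) / e" using False
      by (auto elim: eventually_mono)
    have "\<forall>\<^sub>F n in F. (1 - e) * slice_dist (a n) (c n) \<le> slice_dist r0 c0"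
      by (rule eventually_slice_dist_mix[OF a tendsto_const c tendsto_const _ r0 c0 e nn])
         (use P in \<open>auto elim: eventually_mono\<close>)
    then show ?thesis using P
    proof eventually_elim
      case (elim n)
      have "0 \<le> (1 - e) * slice_dist (a n) (c n)"
        using slice_dist_pos[of "a n" "c n"] elim e by simp
      then have "(1 - e) * ((1 - e) * slice_dist (a n) (c n)) \<le> (1 - e) * slice_dist (a n) (c n)"
        using e by (intro mult_left_le_one_le) auto
      then show ?case using elim by linarith
    qed
  next
    case True
    define c' where "c' n = (c n + a n ^ 3 / 6) / (1 + a n) ^ 3" for n
    have "(c' \<longlongrightarrow> (c0 + r0 ^ 3 / 6) / (1 + r0) ^ 3) F"
      unfolding c'_def by (intro tendsto_intros a c) (use r0 in auto)
    then have c': "(c' \<longlongrightarrow> c0) F" using True by simp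
    have "\<forall>\<^sub>F n in F. 0 < c' n" "\<forall>\<^sub>F n in F. c' n < top_height 0"
      by (rule order_tendstoD[OF c'], use c0 True in simp)+
    then have c'_slice: "\<forall>\<^sub>F n in F. (0, c' n) \<in> slice"
      by eventually_elim (auto simp: slice_def)
    have "\<forall>\<^sub>F n in F. (1 - e) * slice_dist 0 (c' n) \<le> slice_dist 0 c0"
      by (rule eventually_slice_dist_mix[OF tendsto_const tendsto_const c' tendsto_const c'_slice])
         (use c0 True e in auto)
    moreover have "((\<lambda>n. 1 / (1 + a n)) \<longlongrightarrow> 1 / (1 + r0)) F"
      by (intro tendsto_intros a) (use r0 in auto)
    then have "\<forall>\<^sub>F n in F. 1 - e < 1 / (1 + a n)"
      by (rule order_tendstoD(1)) (use True e in simp)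
    ultimately show ?thesis using P c'_slice
    proof eventually_elim
      case (elim n)
      have "(1 - e) * slice_dist (a n) (c n) \<le> 1 / (1 + a n) * slice_dist (a n) (c n)"
        using elim slice_dist_pos[of "a n" "c n"] by (intro mult_right_mono) auto
      also have "\<dots> \<le> slice_dist 0 (c' n)"
        using slice_dist_append[of "a n" "c n"] elim unfolding c'_def by (simp add: field_simps)
      finally have "(1 - e) * ((1 - e) * slice_dist (a n) (c n)) \<le> (1 - e) * slice_dist 0 (c' n)"
        using e by (intro mult_left_mono) auto
      then show ?case using elim True by simp
    qed
  qed
  show ?thesis
  proof (rule tendstoI)
    fix \<eta> :: real assume \<eta>: "0 < \<eta>"
    define e where "e = min 1 (\<eta> / 3)"
    have e: "0 < e" "e \<le> 1" "2 * e < \<eta>" using \<eta> by (auto simp: e_def min_def)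
    show "\<forall>\<^sub>F n in F. dist (slice_dist (a n) (c n)) (slice_dist r0 c0) < \<eta>"
      using lower[OF e(1,2)] upper[OF e(1,2)] P
    proof eventually_elim
      case (elim n)
      let ?f = "slice_dist (a n) (c n)" and ?g = "slice_dist r0 c0"
      have f: "0 \<le> ?f" "?f \<le> 1" and g: "0 \<le> ?g" "?g \<le> 1"
        using slice_dist_pos slice_dist_le_1 P0 elim by (auto intro: less_imp_le)
      have "?g - e \<le> (1 - e) * ?g"
        using mult_left_mono[OF g(2), of e] e by (simp add: algebra_simps)
      moreover have "(1 - e) * ((1 - e) * ?f) = ?f - 2 * (e * ?f) + (e * e) * ?f"
        by (simp add: algebra_simps)
      moreover have "e * ?f \<le> e" using mult_left_mono[OF f(2), of e] e by simp
      moreover have "0 \<le> (e * e) * ?f" using f by simp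
      ultimately have "?g - e \<le> ?f" "?f - 2 * e \<le> ?g" using elim by linarith+
      then show ?case using e by (simp add: dist_real_def)
    qed
  qed
qed

lemma continuous_on_slice_dist: "continuous_on slice (\<lambda>(a, c). slice_dist a c)"
  unfolding continuous_on_def
proof
  fix p assume p: "p \<in> slice"
  have "((\<lambda>q. slice_dist \<bar>fst q\<bar> (snd q)) \<longlongrightarrow> slice_dist \<bar>fst p\<bar> (snd p)) (at p within slice)"
  proof (rule tendsto_slice_dist)
    show "\<forall>\<^sub>F q in at p within slice. (\<bar>fst q\<bar>, snd q) \<in> slice \<and> 0 \<le> \<bar>fst q\<bar>"
      by (auto simp: eventually_at_filter slice_abs)
  qed (use p in \<open>auto intro!: tendsto_intros simp: slice_abs\<close>)
  then show "((\<lambda>(a, c). slice_dist a c) \<longlongrightarrow> (case p of (a, c) \<Rightarrow> slice_dist a c)) (at p within slice)"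
    by (simp add: slice_dist_abs case_prod_unfold)
qed

section \<open>The unit sphere\<close>

lemma sl_dist_slice:
  assumes "0 < y" "(x / y, z / y ^ 3) \<in> slice"
  shows "sl_dist (x, y, z) = ereal (y * slice_dist (x / y) (z / y ^ 3))"
proof -
  let ?L = "lengths_to (x / y, 1, z / y ^ 3)"
  have L: "lengths_to (x, y, z) = (\<lambda>l. y * l) ` ?L"
  proof (intro set_eqI iffI)
    fix l assume "l \<in> lengths_to (x, y, z)"
    from lengths_to_dilate[OF this, of "1 / y"] assms(1) have "l / y \<in> ?L" by (simp add: power_divide)
    then show "l \<in> (\<lambda>l. y * l) ` ?L" using assms(1) by (intro image_eqI[of _ _ "l / y"]) auto
  next
    fix l assume "l \<in> (\<lambda>l. y * l) ` ?L"
    then obtain l' where "l = y * l'" "l' \<in> ?L" by blast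
    then show "l \<in> lengths_to (x, y, z)" using lengths_to_dilate[of l' "x / y" 1 "z / y ^ 3" y] assms(1) by simp
  qed
  have ne: "?L \<noteq> {}" by (rule lengths_to_slice_nonempty[OF assms(2)])
  have "(SUP l\<in>lengths_to (x, y, z). ereal l) = ereal (y * slice_dist (x / y) (z / y ^ 3))"
  proof (rule antisym)
    show "(SUP l\<in>lengths_to (x, y, z). ereal l) \<le> ereal (y * slice_dist (x / y) (z / y ^ 3))"
      unfolding L using le_slice_dist assms(1) by (auto intro!: SUP_least)
    let ?M = "SUP l\<in>lengths_to (x, y, z). ereal l"
    have up: "ereal (y * l) \<le> ?M" if "l \<in> ?L" for l
      by (rule SUP_upper) (use that in \<open>auto simp: L\<close>)
    show "ereal (y * slice_dist (x / y) (z / y ^ 3)) \<le> ?M"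
    proof (cases ?M)
      case (real k)
      have "slice_dist (x / y) (z / y ^ 3) \<le> k / y"
      proof (rule slice_dist_leI[OF ne])
        fix l assume "l \<in> ?L"
        then have "y * l \<le> k" using up real by simp
        then show "l \<le> k / y" using assms(1) by (simp add: field_simps)
      qed
      then show ?thesis using real assms(1) by (simp add: field_simps)
    next
      case MInf
      then show ?thesis using up ne by auto
    qed simp
  qed
  then show ?thesis using ne by (simp add: sl_dist_def L)
qed

text \<open>
  A distance of 1 is a supremum of lengths, so some length is positive. It is at most \<open>y\<close>, whence \<open>y > 0\<close>,
  and dilation to \<open>y = 1\<close> brings the point into the slice.
\<close>

lemma sl_unit_sphere_eq:
  "sl_unit_sphere = {(x, y, z). 0 < y \<and> (x / y, z / y ^ 3) \<in> slice \<and> y * slice_dist (x / y) (z / y ^ 3) = 1}"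
proof -
  have "0 < y \<and> (x / y, z / y ^ 3) \<in> slice" if d: "sl_dist (x, y, z) = 1" for x y z
  proof -
    have "\<exists>l\<in>lengths_to (x, y, z). 0 < l"
    proof (rule ccontr)
      assume "\<not> ?thesis"
      then have "sl_dist (x, y, z) \<le> 0" by (force simp: sl_dist_def intro!: SUP_least)
      then show False using d by simp
    qed
    then obtain l where l: "l \<in> lengths_to (x, y, z)" "0 < l" by blast
    have "l \<le> y" using l(1) trajectory.control_length_le_y unfolding lengths_to_iff by blast
    then have y: "0 < y" using l by simp
    from lengths_to_dilate[OF l(1), of "1 / y"] y have "l / y \<in> lengths_to (x / y, 1, z / y ^ 3)"
      by (simp add: power_divide)
    from slice_of_positive_length[OF this] y l(2) show ?thesis by simp
  qed
  then have "sl_dist (x, y, z) = 1 \<longleftrightarrow>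
      0 < y \<and> (x / y, z / y ^ 3) \<in> slice \<and> y * slice_dist (x / y) (z / y ^ 3) = 1" for x y z
    using sl_dist_slice[of y x z] by (auto simp: one_ereal_def)
  then show ?thesis by (auto simp: sl_unit_sphere_def)
qed

lemma sl_unit_sphere_homeomorphic_slice: "sl_unit_sphere homeomorphic slice"
proof -
  let ?f = "\<lambda>(x, y, z). (x / y, z / y ^ 3) :: real \<times> real"
  let ?g = "\<lambda>(a, c). (a / slice_dist a c, 1 / slice_dist a c, c / slice_dist a c ^ 3) :: R3"
  have fg: "?g p \<in> sl_unit_sphere \<and> ?f (?g p) = p" if "p \<in> slice" for p
  proof -
    obtain a c where p: "p = (a, c)" by (cases p)
    then show ?thesis using that slice_dist_pos[of a c] by (simp add: sl_unit_sphere_eq power_divide)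
  qed
  have gf: "?f q \<in> slice \<and> ?g (?f q) = q" if qS: "q \<in> sl_unit_sphere" for q
  proof -
    obtain x y z where q: "q = (x, y, z)" "0 < y" "(x / y, z / y ^ 3) \<in> slice" "y * slice_dist (x / y) (z / y ^ 3) = 1"
      using qS by (cases q) (auto simp: sl_unit_sphere_eq)
    then have "slice_dist (x / y) (z / y ^ 3) = 1 / y" by (simp add: field_simps)
    then show ?thesis using q by (simp add: power_divide)
  qed
  show ?thesis unfolding homeomorphic_minimal
  proof (rule exI[of _ ?f], rule exI[of _ ?g], intro conjI)
    show "\<forall>q\<in>sl_unit_sphere. ?f q \<in> slice \<and> ?g (?f q) = q" by (intro ballI gf)
    show "\<forall>p\<in>slice. ?g p \<in> sl_unit_sphere \<and> ?f (?g p) = p" by (intro ballI fg)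
    show "continuous_on sl_unit_sphere ?f"
      unfolding split_beta by (intro continuous_intros) (auto simp: sl_unit_sphere_eq)
    have "continuous_on slice (\<lambda>p. slice_dist (fst p) (snd p))"
      using continuous_on_slice_dist by (simp add: split_beta)
    then show "continuous_on slice ?g"
      unfolding split_beta by (intro continuous_intros) (use slice_dist_pos in force)+
  qed
qed

text \<open>
  The ratio in which \<open>c\<close> divides the vertical segment between the least and the greatest height ranges over
  \<open>[0, \<infinity>)\<close>, and \<open>a / (1 - \<bar>a\<bar>)\<close> over the whole line.
\<close>

lemma slice_homeomorphic_half_plane: "slice homeomorphic {(a :: real, b :: real). b \<ge> 0}"
proof -
  let ?H = "{(a :: real, b :: real). b \<ge> 0}"
  let ?f = "\<lambda>(a, c). (a / (1 - \<bar>a\<bar>), (c - \<bar>a\<bar> ^ 3 / 6) / (top_height \<bar>a\<bar> - c)) :: real \<times> real"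
  let ?k = "\<lambda>\<alpha>. \<alpha> / (1 + \<bar>\<alpha>\<bar>) :: real"
  let ?g = "\<lambda>(\<alpha>, b). (?k \<alpha>, (\<bar>?k \<alpha>\<bar> ^ 3 / 6 + b * top_height \<bar>?k \<alpha>\<bar>) / (1 + b)) :: real \<times> real"
  have fg: "?g p \<in> slice \<and> ?f (?g p) = p" if pH: "p \<in> ?H" for p
  proof -
    obtain \<alpha> b where p: "p = (\<alpha>, b)" "0 \<le> b" using pH by (cases p) auto
    define a where "a = ?k \<alpha>"
    have a1: "\<bar>a\<bar> < 1" and aa: "a / (1 - \<bar>a\<bar>) = \<alpha>"
      unfolding a_def by (auto simp: abs_divide divide_simps)
    define B where "B = \<bar>a\<bar> ^ 3 / 6"
    define t where "t = top_height \<bar>a\<bar>"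
    have Bt: "B < t" using bottom_less_top[of "\<bar>a\<bar>"] a1 by (simp add: B_def t_def)
    define c where "c = (B + b * t) / (1 + b)"
    have c1: "c - B = b * (t - B) / (1 + b)" and c2: "t - c = (t - B) / (1 + b)"
      using p(2) by (auto simp: c_def field_simps)
    have "B \<le> c" "c < t" using c1 c2 Bt p(2)
      by (smt (verit) divide_nonneg_nonneg mult_nonneg_nonneg, smt (verit) divide_pos_pos)
    then have "(a, c) \<in> slice" using a1 by (simp add: slice_def B_def t_def)
    moreover have "(c - B) / (t - c) = b" unfolding c1 c2 using Bt p(2) by simp
    then have "?f (a, c) = p" by (simp only: prod.case aa p(1) flip: B_def t_def)
    moreover have "?g p = (a, c)" by (simp only: prod.case p(1) c_def flip: a_def B_def t_def)
    ultimately show ?thesis by simp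
  qed
  have gf: "?f q \<in> ?H \<and> ?g (?f q) = q" if "q \<in> slice" for q
  proof -
    obtain a c where q: "q = (a, c)" by fastforce
    define B where "B = \<bar>a\<bar> ^ 3 / 6"
    define t where "t = top_height \<bar>a\<bar>"
    have a: "\<bar>a\<bar> < 1" and c: "B \<le> c" "c < t" using that by (auto simp: q slice_def B_def t_def)
    have ka: "?k (a / (1 - \<bar>a\<bar>)) = a" using a by (simp add: abs_divide field_simps)
    define b where "b = (c - B) / (t - c)"
    have b0: "0 \<le> b" using c by (simp add: b_def)
    have "b * (t - c) = c - B" using c by (simp add: b_def)
    then have "(B + b * t) / (1 + b) = c" using b0 by (simp add: field_simps)
    then have "?g (a / (1 - \<bar>a\<bar>), b) = q" by (simp only: prod.case ka q flip: B_def t_def)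
    moreover have "?f q = (a / (1 - \<bar>a\<bar>), b)" by (simp only: prod.case q b_def flip: B_def t_def)
    ultimately show ?thesis using b0 by simp
  qed
  show ?thesis unfolding homeomorphic_minimal
  proof (rule exI[of _ ?f], rule exI[of _ ?g], intro conjI)
    show "\<forall>q\<in>slice. ?f q \<in> ?H \<and> ?g (?f q) = q" by (intro ballI gf)
    show "\<forall>p\<in>?H. ?g p \<in> slice \<and> ?f (?g p) = p" by (intro ballI fg)
    show "continuous_on slice ?f"
      unfolding split_beta top_height_def
      by (intro continuous_intros) (auto simp: slice_def top_height_def)
    show "continuous_on ?H ?g"
      unfolding split_beta top_height_def
      by (intro continuous_intros) (auto simp: add_nonneg_eq_0_iff)
  qed
qed

theorem proposition10:
  "sl_unit_sphere homeomorphic {(a :: real, b :: real). b \<ge> 0}"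
  using homeomorphic_trans[OF sl_unit_sphere_homeomorphic_slice slice_homeomorphic_half_plane] .

end
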